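(* Let $\tilde{x}_k$ be the $k$-th iterate of the randomized double block Kaczmarz (RDBK) method applied to the doubly noisy linear system $\widetilde{A}x=\tilde{b}$. Let $x_{LS}=A^{\dagger}b$ and $\tilde{x}_{LS}=\widetilde{A}^{\dagger}\tilde{b}$ be the least-squares solutions of the noiseless system $Ax=b$ and of the doubly noisy system $\widetilde{A}x=\tilde{b}$, respectively. Consider the row partition $\widetilde{A}=(\widetilde{A}_{\tau_1}^{\top},\widetilde{A}_{\tau_2}^{\top},\dots,\widetilde{A}_{\tau_p}^{\top})^{\top}$ with row paving $(p,\alpha_1,\alpha_2)$. For each $i$ let $\widetilde{A}_{\tau_i}=U_i\Sigma_iV_i^{\top}$ be the full singular value decomposition of the row block $\widetilde{A}_{\tau_i}$, let $r_i=\operatorname{rank}(\widetilde{A}_{\tau_i})$, and partition $V_i=[V_{r_i}\mid V_{n-r_i}]$ with $V_{r_i}\in\mathbb{R}^{n\times r_i}$ and $V_{n-r_i}\in\mathbb{R}^{n\times(n-r_i)}$. If the matrix $$\widetilde{A}_{\tau}=\frac{1}{\|\widetilde{A}\|_F}\left(\|\widetilde{A}_{\tau_1}\|_FV_{r_1},\ \|\widetilde{A}_{\tau_2}\|_FV_{r_2},\ \ldots,\ \|\widetilde{A}_{\tau_p}\|_FV_{r_p}\right)\in\mathbb{R}^{n\times\sum_{i=1}^pr_i}$$ has full row rank, then for any initial point $\tilde{x}_0\in\mathbb{R}^n$ and any positive integer $k$, $$\|\mathbb{E}(\tilde{x}_k-x_{LS})\|_2\le(1-\eta)^k\|\tilde{x}_0-x_{LS}\|_2+\frac{\cos\theta_{\gamma}\left(\|\tilde{x}_{LS}\|_2+\frac{\|\tilde{r}\|_2}{\sqrt{\alpha_1}}\right)+\|e_{LS}\|_2+\frac{\|\tilde{b}\|_2}{\sqrt{\alpha_1}}}{\eta},$$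 where $$\cos\theta_{\gamma}=\max_{i\in\{1,\dots,p\}}\cos\angle\left(\tilde{x}_{LS}-\tilde{x}_{LS}^{(i)},\ \mathcal{R}(\widetilde{A}_{\tau_i}^{\top})\right),$$ $\eta=\lambda_{\min}(\widetilde{A}_{\tau}\widetilde{A}_{\tau}^{\top})$, $\tilde{r}=\tilde{b}-\widetilde{A}\tilde{x}_{LS}$, and $e_{LS}=x_{LS}-\tilde{x}_{LS}$.
   Context: $A,\widetilde{A}\in\mathbb{R}^{m\times n}$ and $b,\tilde{b}\in\mathbb{R}^m$ are fixed (deterministic); $\widetilde{A},\tilde{b}$ are noisy versions of $A,b$. Neither $Ax=b$ nor $\widetilde{A}x=\tilde{b}$ is assumed consistent. $M^{\dagger}$ is the Moore-Penrose inverse, $\mathcal{R}(\cdot)$ denotes range, $\|\cdot\|_F$ is the Frobenius norm, $\lambda_{\min},\lambda_{\max}$ are the smallest and largest eigenvalues of a symmetric matrix. $\{\tau_1,\dots,\tau_p\}$ is a partition of the row indices $\{1,\dots,m\}$; $\widetilde{A}_{\tau_i}\in\mathbb{R}^{|\tau_i|\times n}$ is the row submatrix of $\widetilde{A}$ indexed by $\tau_i$, and $v_{\tau_i}$ the subvector of $v\in\mathbb{R}^m$ indexed by $\tau_i$. It is a row paving $(p,\alpha_1,\alpha_2)$ of $\widetilde{A}$ if $$\alpha_1\le\lambda_{\min}(\widetilde{A}_{\tau_i}\widetilde{A}_{\tau_i}^{\top})\quad\text{and}\quad\lambda_{\max}(\widetilde{A}_{\tau_i}\widetilde{A}_{\tau_i}^{\top})\le\alpha_2\quad\text{for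 each }i\in\{1,\dots,p\},$$ where $\alpha_1>0$. $\tilde{x}_{LS}^{(i)}=\widetilde{A}_{\tau_i}^{\dagger}\tilde{b}_{\tau_i}$ is the least-squares solution of the subsystem $\widetilde{A}_{\tau_i}x=\tilde{b}_{\tau_i}$. For a vector $v\ne0$ and a subspace $V$, $\cos\angle(v,V)=\|P_Vv\|_2/\|v\|_2$ with $P_V$ the orthogonal projector onto $V$ (for $v=0$ the value is taken to be $0$). RDBK method: let $\{\nu_1,\dots,\nu_q\}$ be a partition of the column indices $\{1,\dots,n\}$ and $\widetilde{A}_{\nu_j}\in\mathbb{R}^{m\times|\nu_j|}$ the column submatrix of $\widetilde{A}$ indexed by $\nu_j$. Start from $\tilde{x}_0$ and $\tilde{z}_0=\tilde{b}$. At step $k=1,2,\dots$ a column-block index $j_k\in\{1,\dots,q\}$ is drawn with probability $\mathbb{P}(j_k=j)=\|\widetilde{A}_{\nu_j}\|_F^2/\|\widetilde{A}\|_F^2$ and a row-block index $i_k\in\{1,\dots,p\}$ is drawn with probability $\mathbb{P}(i_k=i)=\|\widetilde{A}_{\tau_i}\|_F^2/\|\widetilde{A}\|_F^2$ (all draws independent), and $$\tilde{z}_k=\tilde{z}_{k-1}-\widetilde{A}_{\nu_{j_k}}\widetilde{A}_{\nu_{j_k}}^{\dagger}\tilde{z}_{k-1},\qquad\tilde{x}_k=\tilde{x}_{k-1}+\widetilde{A}_{\tau_{i_k}}^{\dagger}\left(\tilde{b}_{\tau_{i_k}}-(\tilde{z}_k)_{\tau_{i_k}}-\widetilde{A}_{\tau_{i_k}}\tilde{x}_{k-1}\right).$$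 $\mathbb{E}$ denotes expectation over all random index choices. *)

theory Defs
  imports
    "HOL-Probability.Probability"
    "Jordan_Normal_Form.DL_Rank"
    "Jordan_Normal_Form.DL_Submatrix"
    "Jordan_Normal_Form.Spectral_Radius"
begin

text \<open>Matrices and vectors are those of Jordan_Normal_Form, since the blocks have varying sizes.
  Rows, columns and blocks are numbered from 0, so the index sets \<open>{1,\<dots>,m}\<close>, \<open>{1,\<dots>,p}\<close> become
  \<open>{..<m}\<close>, \<open>{..<p}\<close>.  The dimension-indexed vectors of HOL-Analysis are not used; their syntax
  and names are disabled.\<close>

unbundle no vec_syntax
unbundle no inner_syntax
hide_const (open) Finite_Cartesian_Product.mat Finite_Cartesian_Product.vec
  Finite_Cartesian_Product.row Finite_Cartesian_Product.rows
hide_type (open) Finite_Cartesian_Product.vec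

subsection \<open>Linear algebra\<close>

definition norm2 :: "real vec \<Rightarrow> real" where
  "norm2 v = sqrt (v \<bullet> v)"

definition frob_norm :: "real mat \<Rightarrow> real" where
  "frob_norm M = sqrt (\<Sum>i<dim_row M. \<Sum>j<dim_col M. (M $$ (i, j))\<^sup>2)"

text \<open>The Penrose conditions; they have exactly one solution for each \<open>M\<close>.\<close>

definition is_pinv :: "real mat \<Rightarrow> real mat \<Rightarrow> bool" where
  "is_pinv M X \<longleftrightarrow> X \<in> carrier_mat (dim_col M) (dim_row M) \<and>
     M * X * M = M \<and> X * M * X = X \<and> (M * X)\<^sup>T = M * X \<and> (X * M)\<^sup>T = X * M"

definition pinv :: "real mat \<Rightarrow> real mat" where
  "pinv M = (THE X. is_pinv M X)"

text \<open>To be used for symmetric matrices of positive dimension, whose eigenvalues are all real and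
  whose real spectrum is therefore finite and nonempty.\<close>

definition lambda_min :: "real mat \<Rightarrow> real" where
  "lambda_min M = Min (spectrum M)"

definition lambda_max :: "real mat \<Rightarrow> real" where
  "lambda_max M = Max (spectrum M)"

text \<open>The library predicate \<open>orthogonal_mat\<close> only asks for pairwise orthogonal nonzero columns.\<close>

definition orthonormal_mat :: "nat \<Rightarrow> real mat \<Rightarrow> bool" where
  "orthonormal_mat d U \<longleftrightarrow> U \<in> carrier_mat d d \<and> U\<^sup>T * U = 1\<^sub>m d \<and> U * U\<^sup>T = 1\<^sub>m d"

text \<open>Full singular value decomposition \<open>M = U S V\<^sup>T\<close>, singular values in nonincreasing order.\<close>

definition full_svd :: "real mat \<Rightarrow> real mat \<Rightarrow> real mat \<Rightarrow> real mat \<Rightarrow> bool" where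
  "full_svd M U S V \<longleftrightarrow>
     orthonormal_mat (dim_row M) U \<and> orthonormal_mat (dim_col M) V \<and>
     S \<in> carrier_mat (dim_row M) (dim_col M) \<and> diagonal_mat S \<and>
     (\<forall>i < min (dim_row M) (dim_col M). 0 \<le> S $$ (i, i)) \<and>
     (\<forall>i j. i \<le> j \<longrightarrow> j < min (dim_row M) (dim_col M) \<longrightarrow> S $$ (j, j) \<le> S $$ (i, i)) \<and>
     M = U * S * V\<^sup>T"

definition mat_rank :: "real mat \<Rightarrow> nat" where
  "mat_rank M = vec_space.rank (dim_row M) M"

definition mat_range :: "real mat \<Rightarrow> real vec set" where
  "mat_range M = {M *\<^sub>v x | x. x \<in> carrier_vec (dim_col M)}"

definition orth_proj :: "real vec set \<Rightarrow> real vec \<Rightarrow> real vec" where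
  "orth_proj W v = (THE w. w \<in> W \<and> (\<forall>u\<in>W. (v - w) \<bullet> u = 0))"

text \<open>The cosine of the angle between \<open>v\<close> and a subspace \<open>W\<close>, with value 0 at \<open>v = 0\<close> by convention.\<close>

definition cos_angle :: "real vec \<Rightarrow> real vec set \<Rightarrow> real" where
  "cos_angle v W = (if v = 0\<^sub>v (dim_vec v) then 0 else norm2 (orth_proj W v) / norm2 v)"

subsection \<open>Blocks and pavings\<close>

definition row_block :: "real mat \<Rightarrow> nat set \<Rightarrow> real mat" where
  "row_block M I = submatrix M I UNIV"

definition col_block :: "real mat \<Rightarrow> nat set \<Rightarrow> real mat" where
  "col_block M J = submatrix M UNIV J"

text \<open>The entries are kept in increasing order of index, as in \<open>submatrix\<close>.\<close>

definition vec_block :: "real vec \<Rightarrow> nat set \<Rightarrow> real vec" where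
  "vec_block v I = vec (card {i. i < dim_vec v \<and> i \<in> I}) (\<lambda>i. v $ pick I i)"

text \<open>\<open>{\<tau> 0, \<dots>, \<tau> (p - 1)}\<close> is a partition of \<open>{..<m}\<close> into \<open>p\<close> (distinct, nonempty) blocks.\<close>

definition block_partition :: "nat \<Rightarrow> nat \<Rightarrow> (nat \<Rightarrow> nat set) \<Rightarrow> bool" where
  "block_partition m p \<tau> \<longleftrightarrow> inj_on \<tau> {..<p} \<and> partition_on {..<m} (\<tau> ` {..<p})"

definition row_paving :: "real mat \<Rightarrow> nat \<Rightarrow> (nat \<Rightarrow> nat set) \<Rightarrow> real \<Rightarrow> real \<Rightarrow> bool" where
  "row_paving M p \<tau> \<alpha>1 \<alpha>2 \<longleftrightarrow>
     block_partition (dim_row M) p \<tau> \<and> 0 < \<alpha>1 \<and>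
     (\<forall>i<p. \<alpha>1 \<le> lambda_min (row_block M (\<tau> i) * (row_block M (\<tau> i))\<^sup>T) \<and>
            lambda_max (row_block M (\<tau> i) * (row_block M (\<tau> i))\<^sup>T) \<le> \<alpha>2)"

text \<open>\<open>V i\<close> is the right factor of a full singular value decomposition of the \<open>i\<close>-th row block;
  only its first \<open>rank\<close> many columns enter.\<close>

definition leading_cols :: "nat \<Rightarrow> real mat \<Rightarrow> real mat" where
  "leading_cols r M = mat_of_cols (dim_row M) (take r (cols M))"

definition weighted_row_basis :: "real mat \<Rightarrow> nat \<Rightarrow> (nat \<Rightarrow> nat set) \<Rightarrow> (nat \<Rightarrow> real mat) \<Rightarrow> real mat" where
  "weighted_row_basis M p \<tau> V =
     (1 / frob_norm M) \<cdot>\<^sub>m mat_of_cols (dim_col M)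
       (concat (map (\<lambda>i. cols (frob_norm (row_block M (\<tau> i)) \<cdot>\<^sub>m
                                leading_cols (mat_rank (row_block M (\<tau> i))) (V i))) [0..<p]))"

subsection \<open>Randomized double block Kaczmarz\<close>

text \<open>The arguments \<open>ii\<close>, \<open>jj\<close> are the sequences of drawn row and column block indices;
  the values \<open>ii 0\<close>, \<open>jj 0\<close> are never used, the steps being numbered from 1.\<close>

fun rdbk_z :: "real mat \<Rightarrow> real vec \<Rightarrow> (nat \<Rightarrow> nat set) \<Rightarrow> (nat \<Rightarrow> nat) \<Rightarrow> nat \<Rightarrow> real vec" where
  "rdbk_z M b \<nu> jj 0 = b"
| "rdbk_z M b \<nu> jj (Suc k) =
     (let z = rdbk_z M b \<nu> jj k; C = col_block M (\<nu> (jj (Suc k)))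
      in z - C *\<^sub>v (pinv C *\<^sub>v z))"

fun rdbk_x :: "real mat \<Rightarrow> real vec \<Rightarrow> (nat \<Rightarrow> nat set) \<Rightarrow> (nat \<Rightarrow> nat set) \<Rightarrow> real vec \<Rightarrow>
    (nat \<Rightarrow> nat) \<Rightarrow> (nat \<Rightarrow> nat) \<Rightarrow> nat \<Rightarrow> real vec" where
  "rdbk_x M b \<tau> \<nu> x0 ii jj 0 = x0"
| "rdbk_x M b \<tau> \<nu> x0 ii jj (Suc k) =
     (let x = rdbk_x M b \<tau> \<nu> x0 ii jj k; z = rdbk_z M b \<nu> jj (Suc k);
          I = \<tau> (ii (Suc k)); R = row_block M I
      in x + pinv R *\<^sub>v (vec_block b I - vec_block z I - R *\<^sub>v x))"

text \<open>\<open>i k \<omega>\<close> and \<open>j k \<omega>\<close> are the block indices drawn at step \<open>k \<ge> 1\<close>; the whole family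
  \<open>i 1, i 2, \<dots>, j 1, j 2, \<dots>\<close> is independent.\<close>

definition rdbk_draws :: "'w measure \<Rightarrow> real mat \<Rightarrow> nat \<Rightarrow> (nat \<Rightarrow> nat set) \<Rightarrow> nat \<Rightarrow> (nat \<Rightarrow> nat set) \<Rightarrow>
    (nat \<Rightarrow> 'w \<Rightarrow> nat) \<Rightarrow> (nat \<Rightarrow> 'w \<Rightarrow> nat) \<Rightarrow> bool" where
  "rdbk_draws P M p \<tau> q \<nu> i j \<longleftrightarrow>
     prob_space P \<and>
     prob_space.indep_vars P
       (case_sum (\<lambda>_. count_space {..<p}) (\<lambda>_. count_space {..<q}))
       (case_sum i j) ({1..} <+> {1..}) \<and>
     (\<forall>k\<ge>1. \<forall>s<p. measure P {\<omega> \<in> space P. i k \<omega> = s}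
                   = (frob_norm (row_block M (\<tau> s)))\<^sup>2 / (frob_norm M)\<^sup>2) \<and>
     (\<forall>k\<ge>1. \<forall>t<q. measure P {\<omega> \<in> space P. j k \<omega> = t}
                   = (frob_norm (col_block M (\<nu> t)))\<^sup>2 / (frob_norm M)\<^sup>2)"

definition expect_vec :: "'w measure \<Rightarrow> nat \<Rightarrow> ('w \<Rightarrow> real vec) \<Rightarrow> real vec" where
  "expect_vec P d X = vec d (\<lambda>l. \<integral>\<omega>. X \<omega> $ l \<partial>P)"

end

theory Submission
  imports Defs
begin

text \<open>The expected error obeys an affine recursion. Write \<open>R\<^sub>s\<close> for the \<open>s\<close>-th row block of
  \<open>At\<close>, \<open>Q\<^sub>s = R\<^sub>s\<^sup>\<dagger> R\<^sub>s\<close> for the orthogonal projector onto its row space and \<open>w\<^sub>s\<close> for the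
  probability of drawing it; \<open>b\<^sub>s\<close> and \<open>z\<^sub>s\<close> are the corresponding blocks of \<open>bt\<close> and \<open>z\<close>. If block \<open>s\<close> is drawn, then the error \<open>e = x - xLS\<close> becomes
  \<open>e - Q\<^sub>s e + (R\<^sub>s\<^sup>\<dagger> b\<^sub>s - Q\<^sub>s xLS) - R\<^sub>s\<^sup>\<dagger> z\<^sub>s\<close> (\<open>rdbk_step_error\<close>). The drawn index is independent
  of the old error and of the new \<open>z\<close>, so taking expectations gives
  \<open>E e' = (I - W) E e + (\<Sum>s. w\<^sub>s (R\<^sub>s\<^sup>\<dagger> b\<^sub>s - Q\<^sub>s xLS)) - (\<Sum>s. w\<^sub>s R\<^sub>s\<^sup>\<dagger> (E z)\<^sub>s)\<close> with \<open>W = (\<Sum>s. w\<^sub>s Q\<^sub>s)\<close>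
  (\<open>rdbk_draws_next_row\<close>). Each of the three terms is estimated separately.

  \<^item> The paving bound \<open>\<alpha>1 > 0\<close> forces every row block to have full row rank. The leading right
    singular vectors of the block are then an orthonormal basis of its row space, and \<open>W\<close> is exactly
    \<open>At\<tau> At\<tau>\<^sup>T\<close> (\<open>full_svd_row_projector\<close>, \<open>weighted_row_basis_form\<close>). As an average of
    projectors \<open>W\<close> lies between \<open>0\<close> and \<open>I\<close>, so \<open>I - W\<close> shrinks lengths by the factor \<open>1 - \<eta>\<close>
    (\<open>residual_contraction\<close>); full row rank of \<open>At\<tau>\<close> makes \<open>\<eta>\<close> positive.

  \<^item> With \<open>\<delta>\<^sub>s = xtLS - R\<^sub>s\<^sup>\<dagger> b\<^sub>s\<close> one has \<open>R\<^sub>s\<^sup>\<dagger> b\<^sub>s - Q\<^sub>s xLS = - Q\<^sub>s \<delta>\<^sub>s - Q\<^sub>s eLS\<close>. The length of the first part is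
    the length of \<open>\<delta>\<^sub>s\<close> times the cosine of its angle with the row space, and \<open>\<delta>\<^sub>s\<close> splits into the component of \<open>xtLS\<close> orthogonal to
    the row space and the local solution for the residual \<open>rt\<close> (\<open>block_noise_bound\<close>).

  \<^item> Every step of the \<open>z\<close>-iteration is an orthogonal projection, so \<open>E z\<close> is no longer than \<open>bt\<close>,
    and \<open>R\<^sub>s\<^sup>\<dagger>\<close> stretches lengths by at most \<open>1 / sqrt \<alpha>1\<close>
    (\<open>transpose_bounded_below_imp_pinv_right_inverse\<close>).

  Summing the geometric series of the resulting recursion yields the bound
  (\<open>affine_contraction_iterate\<close>). Two pieces of matrix theory carry the rest: the smallest eigenvalue
  of a symmetric matrix is the infimum of its Rayleigh quotient (\<open>Rayleigh_infimum_is_eigenvalue\<close>),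
  and every real matrix has exactly one Moore-Penrose inverse, built from its least-squares inverses
  (\<open>is_pinv_exists\<close>, \<open>is_pinv_unique\<close>).\<close>

section \<open>Euclidean norm and symmetric matrices\<close>

lemma norm2_nonneg: "0 \<le> norm2 v"
  unfolding norm2_def scalar_prod_def by (simp add: sum_nonneg)

lemma scalar_prod_self_nonneg: "0 \<le> v \<bullet> (v :: real vec)"
  unfolding scalar_prod_def by (simp add: sum_nonneg)

lemma norm2_power2: "(norm2 v)\<^sup>2 = v \<bullet> v"
  unfolding norm2_def using scalar_prod_self_nonneg by simp

lemma scalar_prod_self_zero:
  "v \<in> carrier_vec n \<Longrightarrow> v \<bullet> v = (0 :: real) \<Longrightarrow> v = 0\<^sub>v n"
  by (rule eq_vecI) (auto simp: scalar_prod_def sum_nonneg_eq_0_iff)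

lemma norm2_zero [simp]: "norm2 (0\<^sub>v n) = 0"
  by (simp add: norm2_def)

lemma transpose_mult_scalar_prod:
  fixes M :: "real mat"
  assumes "M \<in> carrier_mat m n" "x \<in> carrier_vec n" "y \<in> carrier_vec m"
  shows "(M\<^sup>T *\<^sub>v y) \<bullet> x = y \<bullet> (M *\<^sub>v x)" "(M *\<^sub>v x) \<bullet> y = x \<bullet> (M\<^sup>T *\<^sub>v y)"
  using transpose_vec_mult_scalar[OF assms] assms
  by (simp_all add: comm_scalar_prod[of _ m] comm_scalar_prod[of _ n])

text \<open>The quadratic polynomial \<open>t \<mapsto> (u + t v) \<bullet> B (u + t v)\<close> never becomes negative, which bounds its
  discriminant. The form may be degenerate, so \<open>v \<bullet> B v = 0\<close> is a case of its own. For \<open>B = I\<close> this is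
  the usual Cauchy-Schwarz inequality.\<close>

lemma psd_form_Cauchy_Schwarz:
  fixes B :: "real mat"
  assumes B: "B \<in> carrier_mat n n" and sym: "B\<^sup>T = B"
    and psd: "\<And>v. v \<in> carrier_vec n \<Longrightarrow> 0 \<le> v \<bullet> (B *\<^sub>v v)"
    and u: "u \<in> carrier_vec n" and v: "v \<in> carrier_vec n"
  shows "(u \<bullet> (B *\<^sub>v v))\<^sup>2 \<le> (u \<bullet> (B *\<^sub>v u)) * (v \<bullet> (B *\<^sub>v v))"
proof -
  define a b c where "a = u \<bullet> (B *\<^sub>v u)" and "b = u \<bullet> (B *\<^sub>v v)" and "c = v \<bullet> (B *\<^sub>v v)"
  have vu: "v \<bullet> (B *\<^sub>v u) = b"
    using transpose_mult_scalar_prod(1)[OF B u v] sym B u v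
    unfolding b_def by (simp add: comm_scalar_prod[of _ n])
  have quad: "0 \<le> a + 2 * t * b + t\<^sup>2 * c" for t
  proof -
    have Bw: "B *\<^sub>v (u + t \<cdot>\<^sub>v v) = B *\<^sub>v u + t \<cdot>\<^sub>v (B *\<^sub>v v)"
      using B u v by (simp add: mult_add_distrib_mat_vec[of _ n n] mult_mat_vec[of _ n n])
    have "(u + t \<cdot>\<^sub>v v) \<bullet> (B *\<^sub>v (u + t \<cdot>\<^sub>v v)) = a + 2 * t * b + t\<^sup>2 * c"
      unfolding Bw using B u v vu
      by (simp add: add_scalar_prod_distrib[of _ n] scalar_prod_add_distrib[of _ n]
          smult_scalar_prod_distrib[of _ n] scalar_prod_smult_distrib[of _ n]
          a_def[symmetric] b_def[symmetric] c_def[symmetric]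
          algebra_simps power2_eq_square del: smult_scalar_prod_distrib scalar_prod_smult_distrib)
    thus ?thesis using psd[of "u + t \<cdot>\<^sub>v v"] u v by simp
  qed
  have c0: "0 \<le> c" unfolding c_def by (rule psd[OF v])
  have "b\<^sup>2 \<le> a * c"
  proof (cases "c = 0")
    case True
    have "b = 0"
    proof (rule ccontr)
      \<comment> \<open>the polynomial is then affine with nonzero slope \<open>2 * b\<close>; this \<open>t\<close> gives it the value \<open>-1\<close>\<close>
      assume "b \<noteq> 0"
      hence "a + 2 * (- (a + 1) / (2 * b)) * b = - 1" by (simp add: field_simps)
      thus False using quad[of "- (a + 1) / (2 * b)"] True by simp
    qed
    thus ?thesis using True by simp
  next
    case False
    have "a + 2 * (- b / c) * b + (- b / c)\<^sup>2 * c = a - b\<^sup>2 / c"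
      using False by (simp add: power2_eq_square)
    hence "b\<^sup>2 / c \<le> a" using quad[of "- b / c"] by simp
    thus ?thesis using c0 False by (simp add: pos_divide_le_eq)
  qed
  thus ?thesis unfolding a_def b_def c_def .
qed

lemma scalar_prod_le_norm2:
  assumes u: "u \<in> carrier_vec n" and v: "v \<in> carrier_vec n"
  shows "u \<bullet> v \<le> norm2 u * norm2 v"
proof (rule power2_le_imp_le)
  show "(u \<bullet> v)\<^sup>2 \<le> (norm2 u * norm2 v)\<^sup>2"
    using psd_form_Cauchy_Schwarz[of "1\<^sub>m n" n u v] u v scalar_prod_self_nonneg
    by (simp add: power_mult_distrib norm2_power2)
qed (simp add: norm2_nonneg)

lemma norm2_minus_commute:
  assumes "u \<in> carrier_vec n" "v \<in> carrier_vec n"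
  shows "norm2 (u - v) = norm2 (v - u)"
  using assms unfolding norm2_def scalar_prod_def
  by (auto intro!: arg_cong[of _ _ sqrt] sum.cong simp: algebra_simps)

lemma norm2_triangle:
  assumes u: "u \<in> carrier_vec n" and v: "v \<in> carrier_vec n"
  shows "norm2 (u + v) \<le> norm2 u + norm2 v"
proof (rule power2_le_imp_le)
  have "(norm2 (u + v))\<^sup>2 = (norm2 u)\<^sup>2 + 2 * (u \<bullet> v) + (norm2 v)\<^sup>2"
    using u v by (simp add: norm2_power2 add_scalar_prod_distrib[of _ n]
        scalar_prod_add_distrib[of _ n] comm_scalar_prod[of v n u])
  thus "(norm2 (u + v))\<^sup>2 \<le> (norm2 u + norm2 v)\<^sup>2"
    using scalar_prod_le_norm2[OF u v] by (simp add: power2_sum)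
qed (simp add: norm2_nonneg)

text \<open>The form in which norms are bounded throughout: an estimate of the linear functional \<open>v \<bullet> _\<close> at \<open>v\<close>
  itself.\<close>

lemma norm2_le_of_self_prod:
  assumes "v \<bullet> v \<le> norm2 v * c" and "0 \<le> c"
  shows "norm2 v \<le> c"
proof (cases "norm2 v = 0")
  case False
  hence "0 < norm2 v" using norm2_nonneg[of v] by simp
  thus ?thesis
    using assms(1) norm2_power2[of v] mult_le_cancel_left_pos by (metis power2_eq_square)
qed (use assms in simp)

lemma mult_mat_vec_bounded:
  fixes M :: "real mat"
  assumes M: "M \<in> carrier_mat m n"
  obtains c where "0 \<le> c" "\<And>v. v \<in> carrier_vec n \<Longrightarrow> norm2 (M *\<^sub>v v) \<le> c * norm2 v"
proof
  let ?s = "\<Sum>a<m. (norm2 (row M a))\<^sup>2"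
  have s0: "0 \<le> ?s" by (simp add: sum_nonneg)
  thus "0 \<le> sqrt ?s" by simp
  fix v :: "real vec" assume v: "v \<in> carrier_vec n"
  show "norm2 (M *\<^sub>v v) \<le> sqrt ?s * norm2 v"
  proof (rule power2_le_imp_le)
    have "(norm2 (M *\<^sub>v v))\<^sup>2 = (\<Sum>a<m. (row M a \<bullet> v)\<^sup>2)"
      unfolding norm2_power2 scalar_prod_def[of "M *\<^sub>v v"] using M
      by (simp add: power2_eq_square atLeast0LessThan)
    also have "\<dots> \<le> (\<Sum>a<m. (norm2 (row M a))\<^sup>2 * (norm2 v)\<^sup>2)"
    proof (rule sum_mono)
      fix a assume "a \<in> {..<m}"
      hence r: "row M a \<in> carrier_vec n" using M by auto
      show "(row M a \<bullet> v)\<^sup>2 \<le> (norm2 (row M a))\<^sup>2 * (norm2 v)\<^sup>2"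
        using psd_form_Cauchy_Schwarz[of "1\<^sub>m n" n "row M a" v] r v scalar_prod_self_nonneg
        by (simp add: norm2_power2)
    qed
    also have "\<dots> = (sqrt ?s * norm2 v)\<^sup>2"
      using s0 by (simp add: power_mult_distrib sum_distrib_right)
    finally show "(norm2 (M *\<^sub>v v))\<^sup>2 \<le> (sqrt ?s * norm2 v)\<^sup>2" .
  qed (simp add: s0 norm2_nonneg)
qed

text \<open>Let \<open>\<mu>\<close> be the infimum of the Rayleigh quotient. Then \<open>B = W - \<mu> I\<close> is positive semidefinite. If it
  were invertible, then the Cauchy-Schwarz inequality for the form \<open>B\<close>, applied to \<open>v\<close> and \<open>B\<inverse> v\<close>, would
  bound \<open>v \<bullet> B v\<close> away from 0 on the unit sphere, contradicting the choice of \<open>\<mu>\<close>. Hence \<open>B\<close> is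
  singular.\<close>

lemma Rayleigh_infimum_is_eigenvalue:
  fixes W :: "real mat"
  assumes W: "W \<in> carrier_mat n n" and sym: "W\<^sup>T = W" and n: "0 < n"
  obtains \<mu> where "eigenvalue W \<mu>"
    "\<And>v. v \<in> carrier_vec n \<Longrightarrow> \<mu> * (v \<bullet> v) \<le> v \<bullet> (W *\<^sub>v v)"
proof -
  define R where "R = {v \<bullet> (W *\<^sub>v v) | v. v \<in> carrier_vec n \<and> v \<bullet> v = 1}"
  define \<mu> where "\<mu> = Inf R"
  obtain c where c: "0 \<le> c" "\<And>v. v \<in> carrier_vec n \<Longrightarrow> norm2 (W *\<^sub>v v) \<le> c * norm2 v"
    using mult_mat_vec_bounded[OF W] by blast
  have bdd: "bdd_below R"
  proof (rule bdd_belowI)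
    fix r assume "r \<in> R"
    then obtain v where v: "v \<in> carrier_vec n" "v \<bullet> v = 1" "r = v \<bullet> (W *\<^sub>v v)"
      unfolding R_def by blast
    have "(- v) \<bullet> (W *\<^sub>v v) \<le> norm2 (- v) * norm2 (W *\<^sub>v v)"
      using v W by (intro scalar_prod_le_norm2[of _ n]) auto
    also have "norm2 (- v) = 1" using v(2) by (simp add: norm2_def scalar_prod_def)
    also have "1 * norm2 (W *\<^sub>v v) \<le> c" using c(2)[OF v(1)] v(2) by (simp add: norm2_def)
    also have "(- v) \<bullet> (W *\<^sub>v v) = - r" using v W by simp
    finally show "- c \<le> r" by simp
  qed
  have ne: "R \<noteq> {}"
  proof -
    have "unit_vec n 0 \<bullet> (unit_vec n 0 :: real vec) = 1" using n by simp
    thus ?thesis unfolding R_def using unit_vec_carrier by blast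
  qed
  have ray: "\<mu> * (v \<bullet> v) \<le> v \<bullet> (W *\<^sub>v v)" if v: "v \<in> carrier_vec n" for v
  proof (cases "v \<bullet> v = 0")
    case True
    thus ?thesis using scalar_prod_self_zero[OF v True] W by simp
  next
    case False
    hence pos: "0 < v \<bullet> v" using scalar_prod_self_nonneg[of v] by simp
    define w where "w = (1 / norm2 v) \<cdot>\<^sub>v v"
    have nn: "norm2 v * norm2 v = v \<bullet> v" using norm2_power2[of v] by (simp add: power2_eq_square)
    have w: "w \<in> carrier_vec n" using v by (simp add: w_def)
    have "w \<bullet> w = 1" using v pos by (simp add: w_def nn)
    moreover have "w \<bullet> (W *\<^sub>v w) = v \<bullet> (W *\<^sub>v v) / (v \<bullet> v)"
      using v W by (simp add: w_def mult_mat_vec[of _ n n] nn)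
    ultimately have "v \<bullet> (W *\<^sub>v v) / (v \<bullet> v) \<in> R" using w unfolding R_def by force
    hence "\<mu> \<le> v \<bullet> (W *\<^sub>v v) / (v \<bullet> v)" unfolding \<mu>_def using bdd by (rule cInf_lower)
    thus ?thesis using pos by (simp add: pos_le_divide_eq)
  qed
  define B where "B = char_matrix W \<mu>"
  have B: "B \<in> carrier_mat n n" using W by (simp add: B_def)
  have Bv: "B *\<^sub>v v = W *\<^sub>v v - \<mu> \<cdot>\<^sub>v v" if "v \<in> carrier_vec n" for v
    using that W unfolding B_def char_matrix_def
    by (intro eq_vecI) (auto simp: add_mult_distrib_mat_vec[of _ n n])
  have form: "v \<bullet> (B *\<^sub>v v) = v \<bullet> (W *\<^sub>v v) - \<mu> * (v \<bullet> v)" if "v \<in> carrier_vec n" for v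
    using that W by (simp add: Bv scalar_prod_minus_distrib[of _ n])
  have Bsym: "B\<^sup>T = B"
    using W sym unfolding B_def char_matrix_def by (auto simp: transpose_add[of _ n n])
  have psd: "0 \<le> v \<bullet> (B *\<^sub>v v)" if "v \<in> carrier_vec n" for v
    using ray[OF that] form[OF that] by simp
  have "det B = 0"
  proof (rule ccontr)
    assume "det B \<noteq> 0"
    then obtain C where C: "C \<in> carrier_mat n n" "B * C = 1\<^sub>m n"
      using det_non_zero_imp_unit[OF B] unfolding Units_def ring_mat_def by auto
    obtain d where d: "0 \<le> d" "\<And>v. v \<in> carrier_vec n \<Longrightarrow> norm2 (C *\<^sub>v v) \<le> d * norm2 v"
      using mult_mat_vec_bounded[OF C(1)] by blast
    have lower: "1 \<le> d * (v \<bullet> (W *\<^sub>v v) - \<mu>)" if v: "v \<in> carrier_vec n" "v \<bullet> v = 1" for v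
    proof -
      define u where "u = C *\<^sub>v v"
      have u: "u \<in> carrier_vec n" using C v by (simp add: u_def)
      have Bu: "B *\<^sub>v u = v"
        using assoc_mult_mat_vec[OF B C(1) v(1)] C(2) v by (simp add: u_def)
      have "u \<bullet> (B *\<^sub>v v) = 1"
        using transpose_mult_scalar_prod(2)[OF B u v(1)] Bsym Bu v by simp
      hence "1 \<le> (u \<bullet> (B *\<^sub>v u)) * (v \<bullet> (B *\<^sub>v v))"
        using psd_form_Cauchy_Schwarz[OF B Bsym psd u v(1)] by simp
      also have "\<dots> \<le> d * (v \<bullet> (B *\<^sub>v v))"
      proof (rule mult_right_mono[OF _ psd[OF v(1)]])
        have "u \<bullet> v \<le> norm2 u * norm2 v" by (rule scalar_prod_le_norm2[OF u v(1)])
        also have "\<dots> \<le> d" using d(2)[OF v(1)] v(2) by (simp add: u_def norm2_def)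
        finally show "u \<bullet> (B *\<^sub>v u) \<le> d" by (simp add: Bu)
      qed
      finally show ?thesis using form[OF v(1)] v(2) by simp
    qed
    have dpos: "0 < d"
    proof (rule ccontr)
      assume "\<not> 0 < d"
      hence "d = 0" using d(1) by simp
      thus False using lower[of "unit_vec n 0"] n by simp
    qed
    have "\<mu> + 1 / d \<le> Inf R"
    proof (rule cInf_greatest[OF ne])
      fix r assume "r \<in> R"
      then obtain v where "v \<in> carrier_vec n" "v \<bullet> v = 1" "r = v \<bullet> (W *\<^sub>v v)"
        unfolding R_def by blast
      thus "\<mu> + 1 / d \<le> r" using lower[of v] dpos by (simp add: field_simps)
    qed
    thus False using dpos by (simp add: \<mu>_def)
  qed
  hence "eigenvalue W \<mu>" using eigenvalue_det[OF W] by (simp add: B_def)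
  thus ?thesis using ray that by blast
qed

lemma lambda_min_Rayleigh:
  fixes W :: "real mat"
  assumes W: "W \<in> carrier_mat n n" and sym: "W\<^sup>T = W" and n: "0 < n"
  shows "eigenvalue W (lambda_min W)"
    and "\<And>v. v \<in> carrier_vec n \<Longrightarrow> lambda_min W * (v \<bullet> v) \<le> v \<bullet> (W *\<^sub>v v)"
proof -
  obtain \<mu> where \<mu>: "eigenvalue W \<mu>"
    "\<And>v. v \<in> carrier_vec n \<Longrightarrow> \<mu> * (v \<bullet> v) \<le> v \<bullet> (W *\<^sub>v v)"
    using Rayleigh_infimum_is_eigenvalue[OF assms] by blast
  have "lambda_min W = \<mu>" unfolding lambda_min_def
  proof (rule Min_eqI)
    show "finite (spectrum W)" by (rule card_finite_spectrum[OF W])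
    show "\<mu> \<in> spectrum W" using \<mu>(1) by (simp add: spectrum_def)
    fix \<kappa> assume "\<kappa> \<in> spectrum W"
    then obtain v where v: "v \<in> carrier_vec n" "v \<noteq> 0\<^sub>v n" "W *\<^sub>v v = \<kappa> \<cdot>\<^sub>v v"
      using W unfolding spectrum_def eigenvalue_def eigenvector_def by auto
    have "0 < v \<bullet> v"
      using v scalar_prod_self_zero[OF v(1)] scalar_prod_self_nonneg[of v] by fastforce
    moreover have "\<mu> * (v \<bullet> v) \<le> \<kappa> * (v \<bullet> v)" using \<mu>(2)[OF v(1)] v by simp
    ultimately show "\<mu> \<le> \<kappa>" by simp
  qed
  thus "eigenvalue W (lambda_min W)"
    and "\<And>v. v \<in> carrier_vec n \<Longrightarrow> lambda_min W * (v \<bullet> v) \<le> v \<bullet> (W *\<^sub>v v)"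
    using \<mu> by simp_all
qed

section \<open>The Moore-Penrose inverse\<close>

lemma mat_of_cols_Cons_mult_vCons:
  assumes x: "x \<in> carrier_vec (length vs)" and a: "a \<in> carrier_vec n"
  shows "mat_of_cols n (a # vs) *\<^sub>v vCons c x = (c :: real) \<cdot>\<^sub>v a + mat_of_cols n vs *\<^sub>v x"
proof (rule eq_vecI)
  fix r assume "r < dim_vec (c \<cdot>\<^sub>v a + mat_of_cols n vs *\<^sub>v x)"
  hence r: "r < n" by simp
  have "row (mat_of_cols n (a # vs)) r = vCons (a $ r) (row (mat_of_cols n vs) r)"
    using r by (intro eq_vecI) (auto simp: mat_of_cols_index vec_index_vCons nth_Cons')
  thus "(mat_of_cols n (a # vs) *\<^sub>v vCons c x) $ r = (c \<cdot>\<^sub>v a + mat_of_cols n vs *\<^sub>v x) $ r"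
    using r a by simp
qed simp

text \<open>One step of Gram-Schmidt per column: subtract from the new column \<open>a\<close> its projection onto the previous
  ones and project the remaining part \<open>p\<close> of \<open>y\<close> onto the difference \<open>g\<close>. The columns may be linearly
  dependent.\<close>

lemma orthogonal_projection_onto_columns:
  fixes y :: "real vec"
  assumes "set vs \<subseteq> carrier_vec n" and "y \<in> carrier_vec n"
  shows "\<exists>x\<in>carrier_vec (length vs). \<forall>v\<in>set vs. (y - mat_of_cols n vs *\<^sub>v x) \<bullet> v = 0"
  using assms
proof (induction vs arbitrary: y)
  case Nil
  show ?case by (intro bexI[of _ "0\<^sub>v 0"]) auto
next
  case (Cons a vs)
  let ?M = "mat_of_cols n vs"
  have a: "a \<in> carrier_vec n" and vs: "set vs \<subseteq> carrier_vec n" and y: "y \<in> carrier_vec n"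
    using Cons.prems by auto
  obtain u where u: "u \<in> carrier_vec (length vs)" and u0: "\<And>v. v \<in> set vs \<Longrightarrow> (y - ?M *\<^sub>v u) \<bullet> v = 0"
    using Cons.IH[OF vs y] by blast
  obtain w where w: "w \<in> carrier_vec (length vs)" and w0: "\<And>v. v \<in> set vs \<Longrightarrow> (a - ?M *\<^sub>v w) \<bullet> v = 0"
    using Cons.IH[OF vs a] by blast
  have M: "?M \<in> carrier_mat n (length vs)" by simp
  have comb: "r \<bullet> (?M *\<^sub>v x) = 0"
    if r: "r \<in> carrier_vec n" "\<And>v. v \<in> set vs \<Longrightarrow> r \<bullet> v = 0" and x: "x \<in> carrier_vec (length vs)" for r x
  proof -
    have "?M\<^sup>T *\<^sub>v r = 0\<^sub>v (length vs)"
    proof (rule eq_vecI)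
      fix l assume l: "l < dim_vec (0\<^sub>v (length vs) :: real vec)"
      hence "vs ! l \<in> carrier_vec n" "vs ! l \<in> set vs" using vs by auto
      thus "(?M\<^sup>T *\<^sub>v r) $ l = 0\<^sub>v (length vs) $ l"
        using l r by (simp add: comm_scalar_prod[of "vs ! l" n r])
    qed simp
    thus ?thesis using transpose_mult_scalar_prod(1)[OF M x r(1)] x by simp
  qed
  define p where "p = y - ?M *\<^sub>v u"
  define g where "g = a - ?M *\<^sub>v w"
  have p: "p \<in> carrier_vec n" and g: "g \<in> carrier_vec n" using y a mult_mat_vec_carrier[OF M u] mult_mat_vec_carrier[OF M w]
    unfolding p_def g_def by (simp_all del: mult_mat_vec_carrier)
  \<comment> \<open>for \<open>g = 0\<close> the division by zero yields the correct coefficient 0\<close>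
  define c where "c = (p \<bullet> g) / (g \<bullet> g)"
  define x where "x = vCons c (u - c \<cdot>\<^sub>v w)"
  have x: "x \<in> carrier_vec (length (a # vs))" using u w by (simp add: x_def)
  have "mat_of_cols n (a # vs) *\<^sub>v x = c \<cdot>\<^sub>v a + (?M *\<^sub>v u - c \<cdot>\<^sub>v (?M *\<^sub>v w))"
    using u w a M unfolding x_def
    by (subst mat_of_cols_Cons_mult_vCons) (auto simp: mult_minus_distrib_mat_vec[OF M] mult_mat_vec[OF M])
  hence res: "y - mat_of_cols n (a # vs) *\<^sub>v x = p - c \<cdot>\<^sub>v g"
    unfolding p_def g_def using y a by (intro eq_vecI) (auto simp: algebra_simps)
  have orth: "(p - c \<cdot>\<^sub>v g) \<bullet> v = 0" if "v \<in> set vs" for v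
    using that vs p g u0[OF that] w0[OF that]
    by (subst minus_scalar_prod_distrib[of _ n]) (auto simp: p_def[symmetric] g_def[symmetric])
  have "(p - c \<cdot>\<^sub>v g) \<bullet> g = 0"
  proof (cases "g \<bullet> g = 0")
    case True
    hence "g = 0\<^sub>v n" by (rule scalar_prod_self_zero[OF g])
    thus ?thesis using p by simp
  next
    case False
    thus ?thesis using p g by (simp add: minus_scalar_prod_distrib[of _ n] c_def)
  qed
  moreover have "(p - c \<cdot>\<^sub>v g) \<bullet> (?M *\<^sub>v w) = 0" using comb[OF _ orth w] p g by simp
  moreover have "a = g + ?M *\<^sub>v w" unfolding g_def using a by (intro eq_vecI) auto
  moreover have "(p - c \<cdot>\<^sub>v g) \<bullet> (g + ?M *\<^sub>v w) = (p - c \<cdot>\<^sub>v g) \<bullet> g + (p - c \<cdot>\<^sub>v g) \<bullet> (?M *\<^sub>v w)"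
    using p g mult_mat_vec_carrier[OF M w] by (intro scalar_prod_add_distrib[of _ n]) auto
  ultimately have "(p - c \<cdot>\<^sub>v g) \<bullet> a = 0" by simp
  thus ?case using orth x res by (intro bexI[of _ x]) auto
qed

lemma normal_equations_solvable:
  fixes M :: "real mat"
  assumes M: "M \<in> carrier_mat m n"
  obtains G where "G \<in> carrier_mat n m" "M\<^sup>T * (M * G) = M\<^sup>T"
proof -
  have "\<exists>x\<in>carrier_vec n. M\<^sup>T *\<^sub>v (M *\<^sub>v x) = M\<^sup>T *\<^sub>v y" if y: "y \<in> carrier_vec m" for y
  proof -
    have "set (cols M) \<subseteq> carrier_vec m" using M cols_dim by blast
    then obtain x where x: "x \<in> carrier_vec n" "\<forall>v\<in>set (cols M). (y - M *\<^sub>v x) \<bullet> v = 0"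
      using orthogonal_projection_onto_columns[OF _ y, of "cols M"] M by auto
    have "M\<^sup>T *\<^sub>v (M *\<^sub>v x) = M\<^sup>T *\<^sub>v y"
    proof (rule eq_vecI)
      fix l assume "l < dim_vec (M\<^sup>T *\<^sub>v y)"
      hence l: "l < n" using M by simp
      have c: "col M l \<in> carrier_vec m" using M by auto
      have "(y - M *\<^sub>v x) \<bullet> col M l = 0" using x(2) l M by (auto simp: cols_def)
      hence "y \<bullet> col M l = (M *\<^sub>v x) \<bullet> col M l"
        using x(1) y M c by (simp add: minus_scalar_prod_distrib[of _ m])
      thus "(M\<^sup>T *\<^sub>v (M *\<^sub>v x)) $ l = (M\<^sup>T *\<^sub>v y) $ l"
        using l M y x c by (simp add: comm_scalar_prod[of "col M l" m])
    qed (use M in simp)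
    thus ?thesis using x by blast
  qed
  hence "\<forall>y\<in>carrier_vec m. \<exists>x. x \<in> carrier_vec n \<and> M\<^sup>T *\<^sub>v (M *\<^sub>v x) = M\<^sup>T *\<^sub>v y" by blast
  from bchoice[OF this] obtain f where
    f: "\<forall>y\<in>carrier_vec m. f y \<in> carrier_vec n \<and> M\<^sup>T *\<^sub>v (M *\<^sub>v f y) = M\<^sup>T *\<^sub>v y"
    by blast
  define G where "G = mat n m (\<lambda>(r, l). f (unit_vec m l) $ r)"
  have G: "G \<in> carrier_mat n m" by (simp add: G_def)
  have "M\<^sup>T * (M * G) = M\<^sup>T"
  proof (rule mat_col_eqI)
    fix l assume "l < dim_col (M\<^sup>T)"
    hence l: "l < m" using M by simp
    have fl: "f (unit_vec m l) \<in> carrier_vec n"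
      "M\<^sup>T *\<^sub>v (M *\<^sub>v f (unit_vec m l)) = M\<^sup>T *\<^sub>v unit_vec m l"
      using f by auto
    hence cG: "col G l = f (unit_vec m l)" using l by (intro eq_vecI) (auto simp: G_def)
    have "col (M\<^sup>T * (M * G)) l = M\<^sup>T *\<^sub>v (M *\<^sub>v col G l)"
      using M G l col_mult2[of "M\<^sup>T" n m "M * G" m l] col_mult2[OF M G l] by simp
    also have "\<dots> = M\<^sup>T *\<^sub>v unit_vec m l" unfolding cG by (rule fl(2))
    also have "\<dots> = col (M\<^sup>T) l" using M l by (intro eq_vecI) auto
    finally show "col (M\<^sup>T * (M * G)) l = col (M\<^sup>T) l" .
  qed (use M G in auto)
  thus ?thesis using G that by blast
qed

text \<open>If \<open>M\<^sup>T M G = M\<^sup>T\<close>, then \<open>(M G)\<^sup>T M = M\<close>; multiplying by \<open>G\<close> shows that \<open>M G = (M G)\<^sup>T (M G)\<close> is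
  symmetric.\<close>

lemma least_squares_inverse:
  fixes M :: "real mat"
  assumes M: "M \<in> carrier_mat m n"
  obtains G where "G \<in> carrier_mat n m" "M * G * M = M" "(M * G)\<^sup>T = M * G"
proof -
  obtain G where G: "G \<in> carrier_mat n m" "M\<^sup>T * (M * G) = M\<^sup>T"
    using normal_equations_solvable[OF M] by blast
  have MG: "M * G \<in> carrier_mat m m" using M G by simp
  have e: "(M * G)\<^sup>T * M = M"
    using arg_cong[OF G(2), of transpose_mat] M MG by (simp add: transpose_mult[of _ n m _ m])
  have s: "(M * G)\<^sup>T * (M * G) = M * G"
    using assoc_mult_mat[of "(M * G)\<^sup>T" m m M n G m] e M G(1) MG by simp
  have "(M * G)\<^sup>T = M * G"
    using transpose_mult[of "(M * G)\<^sup>T" m m "M * G" m] s MG by simp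
  thus ?thesis using e G(1) that by metis
qed

text \<open>Least-squares inverses \<open>G\<close> of \<open>M\<close> and \<open>K\<close> of \<open>M\<^sup>T\<close> provide the projectors onto the column space and
  the row space of \<open>M\<close>; the Moore-Penrose inverse is \<open>K\<^sup>T M G\<close>.\<close>

lemma is_pinv_exists:
  assumes M: "M \<in> carrier_mat m n"
  shows "\<exists>X. is_pinv M X"
proof -
  obtain G where G: "G \<in> carrier_mat n m" "M * G * M = M" "(M * G)\<^sup>T = M * G"
    using least_squares_inverse[OF M] by blast
  obtain K where K: "K \<in> carrier_mat m n" "M\<^sup>T * K * M\<^sup>T = M\<^sup>T" "(M\<^sup>T * K)\<^sup>T = M\<^sup>T * K"
    using least_squares_inverse[of "M\<^sup>T" n m] M by auto
  define H where "H = K\<^sup>T"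
  have H: "H \<in> carrier_mat n m" using K by (simp add: H_def)
  have HM: "H * M = M\<^sup>T * K"
    using K(3) transpose_mult[of "M\<^sup>T" n m K n] K(1) M by (simp add: H_def)
  have HMs: "(H * M)\<^sup>T = H * M" using K(3) HM by simp
  have MHM: "M * H * M = M"
  proof -
    have "M = (M\<^sup>T * K * M\<^sup>T)\<^sup>T" by (simp add: K(2))
    also have "\<dots> = M * (H * M)"
      using transpose_mult[of "M\<^sup>T * K" n n "M\<^sup>T" m] K(1,3) M by (simp add: HM)
    finally show ?thesis using assoc_mult_mat[OF M H M] by simp
  qed
  define X where "X = H * (M * G)"
  have X: "X \<in> carrier_mat n m" using H M G by (simp add: X_def)
  have MX: "M * X = M * G"
  proof -
    have "M * X = M * H * (M * G)"
      unfolding X_def using assoc_mult_mat[OF M H, of "M * G" m] M G by simp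
    also have "\<dots> = M * G" using assoc_mult_mat[of "M * H" m m M n G m] MHM M H G by simp
    finally show ?thesis .
  qed
  have XM: "X * M = H * M"
    unfolding X_def using assoc_mult_mat[of H n m "M * G" m M n] G M H by simp
  have "X * M * X = X"
  proof -
    have "X * M * X = H * (M * X)" unfolding XM by (rule assoc_mult_mat[OF H M X])
    thus ?thesis unfolding MX by (simp only: X_def)
  qed
  thus ?thesis using X M G HMs MX XM unfolding is_pinv_def by (intro exI[of _ X]) simp
qed

lemma is_pinvD:
  assumes "M \<in> carrier_mat m n" and "is_pinv M X"
  shows "X \<in> carrier_mat n m" "M * X * M = M" "X * M * X = X"
    "(M * X)\<^sup>T = M * X" "(X * M)\<^sup>T = X * M" "M * (X * M) = M" "X * (M * X) = X"
proof -
  show c: "X \<in> carrier_mat n m" using assms unfolding is_pinv_def by blast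
  show "M * X * M = M" "X * M * X = X" using assms unfolding is_pinv_def by blast+
  thus "M * (X * M) = M" "X * (M * X) = X"
    unfolding assoc_mult_mat[OF assms(1) c assms(1)] assoc_mult_mat[OF c assms(1) c] .
  show "(M * X)\<^sup>T = M * X" "(X * M)\<^sup>T = X * M" using assms unfolding is_pinv_def by blast+
qed

text \<open>The projectors \<open>M X\<close> and \<open>M Y\<close> have the same range and are symmetric, so they agree; likewise \<open>X M\<close> and
  \<open>Y M\<close>. Together they determine \<open>X = X M X\<close>.\<close>

lemma is_pinv_unique:
  assumes M: "M \<in> carrier_mat m n" and X: "is_pinv M X" and Y: "is_pinv M Y"
  shows "X = Y"
proof -
  note X = is_pinvD[OF M X] and Y = is_pinvD[OF M Y]
  have MX: "M * X \<in> carrier_mat m m" and MY: "M * Y \<in> carrier_mat m m"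
    and XM: "X * M \<in> carrier_mat n n" and YM: "Y * M \<in> carrier_mat n n"
    using M X(1) Y(1) by auto
  have left: "M * X = M * Y"
  proof -
    have "M * X = (M * Y) * (M * X)"
      using assoc_mult_mat[OF MY M X(1)] unfolding Y(2) .
    also have "\<dots> = ((M * X) * (M * Y))\<^sup>T" unfolding transpose_mult[OF MX MY] X(4) Y(4) ..
    also have "(M * X) * (M * Y) = M * Y"
      using assoc_mult_mat[OF MX M Y(1)] unfolding X(2) by (rule sym)
    finally show ?thesis unfolding Y(4) .
  qed
  have right: "X * M = Y * M"
  proof -
    have "X * M = (X * M) * (Y * M)"
      unfolding assoc_mult_mat[OF X(1) M YM] Y(6) ..
    also have "\<dots> = ((Y * M) * (X * M))\<^sup>T" unfolding transpose_mult[OF YM XM] X(5) Y(5) ..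
    also have "(Y * M) * (X * M) = Y * M"
      unfolding assoc_mult_mat[OF Y(1) M XM] X(6) ..
    finally show ?thesis unfolding Y(5) .
  qed
  have "X = X * (M * X)" by (rule X(7)[symmetric])
  also have "\<dots> = Y * M * Y"
    unfolding left assoc_mult_mat[OF X(1) M Y(1), symmetric] right ..
  finally show ?thesis unfolding Y(3) .
qed

lemma is_pinv_pinv:
  assumes M: "M \<in> carrier_mat m n"
  shows "is_pinv M (pinv M)"
  unfolding pinv_def
  by (rule theI', rule ex_ex1I[OF is_pinv_exists[OF M]]) (rule is_pinv_unique[OF M])

lemmas pinvD = is_pinvD[OF _ is_pinv_pinv]

section \<open>Orthogonal projectors\<close>

lemma symmetric_idempotent_contracts:
  fixes Q :: "real mat"
  assumes Q: "Q \<in> carrier_mat n n" and sym: "Q\<^sup>T = Q" and idem: "Q * Q = Q"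
    and v: "v \<in> carrier_vec n"
  shows "norm2 (Q *\<^sub>v v) \<le> norm2 v" and "norm2 (v - Q *\<^sub>v v) \<le> norm2 v"
    and "v \<bullet> (Q *\<^sub>v v) \<le> v \<bullet> v"
proof -
  define u where "u = Q *\<^sub>v v"
  have u: "u \<in> carrier_vec n" using Q v by (simp add: u_def)
  have "Q *\<^sub>v u = u" using assoc_mult_mat_vec[OF Q Q v] idem by (simp add: u_def)
  hence uu: "u \<bullet> u = v \<bullet> u"
    using transpose_mult_scalar_prod(2)[OF Q v u] sym by (simp add: u_def)
  hence rr: "(v - u) \<bullet> (v - u) = (v - u) \<bullet> v"
    using u v by (simp add: minus_scalar_prod_distrib[of _ n] scalar_prod_minus_distrib[of _ n]
        comm_scalar_prod[of u n v])
  show "norm2 (Q *\<^sub>v v) \<le> norm2 v"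
    using scalar_prod_le_norm2[OF u v] uu comm_scalar_prod[OF u v] norm2_nonneg
    by (intro norm2_le_of_self_prod) (simp_all add: u_def)
  show "norm2 (v - Q *\<^sub>v v) \<le> norm2 v"
    using scalar_prod_le_norm2[of "v - u" n v] rr u v norm2_nonneg
    by (intro norm2_le_of_self_prod) (simp_all add: u_def)
  have "(v - u) \<bullet> v = v \<bullet> v - v \<bullet> u"
    using u v by (simp add: minus_scalar_prod_distrib[of _ n] comm_scalar_prod[of u n v])
  thus "v \<bullet> (Q *\<^sub>v v) \<le> v \<bullet> v"
    using rr scalar_prod_self_nonneg[of "v - u"] by (simp add: u_def)
qed

definition row_projector :: "real mat \<Rightarrow> real mat" where
  "row_projector M = pinv M * M"

lemma row_projector:
  assumes M: "M \<in> carrier_mat m n"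
  shows "row_projector M \<in> carrier_mat n n" "(row_projector M)\<^sup>T = row_projector M"
    "row_projector M * row_projector M = row_projector M"
    "row_projector M * pinv M = pinv M" "row_projector M * M\<^sup>T = M\<^sup>T"
    "row_projector M = M\<^sup>T * (pinv M)\<^sup>T" "M * row_projector M = M"
proof -
  note p = pinvD[OF M M]
  show c: "row_projector M \<in> carrier_mat n n" using p(1) M by (simp add: row_projector_def)
  show s: "(row_projector M)\<^sup>T = row_projector M" unfolding row_projector_def by (rule p(5))
  show i: "row_projector M * pinv M = pinv M" unfolding row_projector_def by (rule p(3))
  show "row_projector M * row_projector M = row_projector M"
    using i assoc_mult_mat[OF c p(1) M] unfolding row_projector_def by metis
  show e: "M * row_projector M = M" unfolding row_projector_def by (rule p(6))
  show "row_projector M * M\<^sup>T = M\<^sup>T"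
    using transpose_mult[OF M c] unfolding e s by (rule sym)
  show "row_projector M = M\<^sup>T * (pinv M)\<^sup>T"
    using s transpose_mult[OF p(1) M] unfolding row_projector_def by metis
qed

text \<open>This bounds one step of the \<open>z\<close>-iteration, for a column block of arbitrary rank.\<close>

lemma range_projector_contracts:
  assumes M: "M \<in> carrier_mat m n" and z: "z \<in> carrier_vec m"
  shows "norm2 (z - M *\<^sub>v (pinv M *\<^sub>v z)) \<le> norm2 z"
proof -
  note p = pinvD[OF M M]
  have Q: "M * pinv M \<in> carrier_mat m m" using M p(1) by simp
  have "M * pinv M * (M * pinv M) = M * pinv M"
    unfolding assoc_mult_mat[OF Q M p(1), symmetric] p(2) ..
  thus ?thesis
    using symmetric_idempotent_contracts(2)[OF Q p(4) _ z] assoc_mult_mat_vec[OF M p(1) z] by simp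
qed

lemma orth_proj_row_space:
  assumes M: "M \<in> carrier_mat m n" and v: "v \<in> carrier_vec n"
  shows "orth_proj (mat_range (M\<^sup>T)) v = row_projector M *\<^sub>v v"
proof -
  let ?P = "row_projector M"
  note X = pinvD(1)[OF M M] and P = row_projector[OF M]
  have in_range: "?P *\<^sub>v v = M\<^sup>T *\<^sub>v ((pinv M)\<^sup>T *\<^sub>v v)"
    using P(6) X M v by simp
  have orth: "(v - ?P *\<^sub>v v) \<bullet> (M\<^sup>T *\<^sub>v y) = 0" if y: "y \<in> carrier_vec m" for y
  proof -
    have "M *\<^sub>v (v - ?P *\<^sub>v v) = 0\<^sub>v m"
      using P(1,7) M v assoc_mult_mat_vec[OF M P(1) v]
      by (simp add: mult_minus_distrib_mat_vec[OF M])
    thus ?thesis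
      using transpose_mult_scalar_prod(2)[OF M, of "v - ?P *\<^sub>v v" y] P(1) v y by simp
  qed
  have "(THE w. w \<in> mat_range (M\<^sup>T) \<and> (\<forall>u\<in>mat_range (M\<^sup>T). (v - w) \<bullet> u = 0)) = ?P *\<^sub>v v"
  proof (rule the_equality)
    show "?P *\<^sub>v v \<in> mat_range (M\<^sup>T) \<and> (\<forall>u\<in>mat_range (M\<^sup>T). (v - ?P *\<^sub>v v) \<bullet> u = 0)"
      using in_range orth X M v unfolding mat_range_def by fastforce
  next
    fix w assume w: "w \<in> mat_range (M\<^sup>T) \<and> (\<forall>u\<in>mat_range (M\<^sup>T). (v - w) \<bullet> u = 0)"
    then obtain y where y: "y \<in> carrier_vec m" "w = M\<^sup>T *\<^sub>v y"
      using M unfolding mat_range_def by auto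
    define t where "t = (pinv M)\<^sup>T *\<^sub>v v"
    have t: "t \<in> carrier_vec m" using X v by (simp add: t_def)
    define d where "d = M\<^sup>T *\<^sub>v (y - t)"
    have d: "d \<in> carrier_vec n" using M y t by (simp add: d_def)
    have wc: "w \<in> carrier_vec n" using y M by simp
    have deq: "d = w - ?P *\<^sub>v v"
      unfolding d_def in_range t_def[symmetric] y(2)
      using M y t by (simp add: mult_minus_distrib_mat_vec[of _ n m])
    have "d \<in> mat_range (M\<^sup>T)" unfolding mat_range_def d_def using M y t by auto
    hence "(v - w) \<bullet> d = 0" "(v - ?P *\<^sub>v v) \<bullet> d = 0"
      using w orth[of "y - t"] y t by (auto simp: d_def)
    hence "d \<bullet> d = 0"
      unfolding deq using v wc P(1)
      by (simp add: minus_scalar_prod_distrib[of _ n])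
    hence "d = 0\<^sub>v n" by (rule scalar_prod_self_zero[OF d])
    hence z: "(w - ?P *\<^sub>v v) $ l = 0" if "l < n" for l using that by (simp add: deq[symmetric])
    show "w = ?P *\<^sub>v v"
    proof (rule eq_vecI)
      fix l assume "l < dim_vec (?P *\<^sub>v v)"
      thus "w $ l = (?P *\<^sub>v v) $ l" using z[of l] wc P(1) by simp
    qed (use wc P(1) in simp)
  qed
  thus ?thesis by (simp add: orth_proj_def)
qed

lemma norm2_row_projection:
  assumes M: "M \<in> carrier_mat m n" and v: "v \<in> carrier_vec n"
  shows "norm2 (row_projector M *\<^sub>v v) = cos_angle v (mat_range (M\<^sup>T)) * norm2 v"
proof (cases "v = 0\<^sub>v n")
  case True
  hence "row_projector M *\<^sub>v v = 0\<^sub>v n"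
    using row_projector(1)[OF M] by (intro eq_vecI) auto
  thus ?thesis using True by simp
next
  case False
  hence "norm2 v \<noteq> 0"
    using scalar_prod_self_zero[OF v] norm2_power2[of v] by auto
  thus ?thesis using False v by (simp add: cos_angle_def orth_proj_row_space[OF M v])
qed

lemma cos_angle_nonneg: "0 \<le> cos_angle v W"
  by (simp add: cos_angle_def norm2_nonneg)

section \<open>Rank and range\<close>

text \<open>A maximal independent set of columns has as many elements as the dimension of the space, so it is
  a basis of the whole space.\<close>

lemma full_row_rank_imp_surj:
  fixes M :: "real mat"
  assumes M: "M \<in> carrier_mat d c" and rank: "mat_rank M = d" and y: "y \<in> carrier_vec d"
  shows "\<exists>x\<in>carrier_vec c. M *\<^sub>v x = y"
proof -
  interpret vec_space "TYPE(real)" d .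
  have fin: "finite (set (cols M))" and sub: "set (cols M) \<subseteq> carrier_vec d"
    using M cols_dim[of M] by auto
  obtain S where S: "maximal S (\<lambda>T. T \<subseteq> set (cols M) \<and> lin_indpt T)"
    using maximal_exists[of "\<lambda>T. T \<subseteq> set (cols M) \<and> lin_indpt T" "card (set (cols M))" "{}"]
    by (meson List.finite_set card_mono empty_iff empty_subsetI finite_lin_indpt2 rev_finite_subset)
  have "card S = d" using rank_card_indpt[OF M S] rank M by (simp add: mat_rank_def)
  moreover have Ss: "S \<subseteq> set (cols M)" "lin_indpt S" using S by (auto simp: maximal_def)
  ultimately have "basis S"
    using fin sub by (intro dim_li_is_basis) (auto simp: dim_is_n intro: finite_subset)
  hence "y \<in> span S" using y by (simp add: basis_def)
  moreover have "span S \<subseteq> span (set (cols M))" using Ss(1) by (rule span_is_monotone)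
  ultimately have "y \<in> col_space M" by (auto simp: col_space_def)
  thus ?thesis using col_space_eq[OF M] M by auto
qed

lemma surj_imp_full_row_rank:
  fixes M :: "real mat"
  assumes M: "M \<in> carrier_mat d c"
    and surj: "\<And>y. y \<in> carrier_vec d \<Longrightarrow> \<exists>x\<in>carrier_vec c. M *\<^sub>v x = y"
  shows "mat_rank M = d"
proof -
  interpret vec_space "TYPE(real)" d .
  have "col_space M = carrier_vec d" using col_space_eq[OF M] M surj by auto
  hence "span_vs (set (cols M)) = V" by (simp add: col_space_def)
  thus ?thesis using M by (simp add: mat_rank_def rank_def dim_is_n)
qed

lemma full_row_rank_imp_transpose_inj:
  fixes M :: "real mat"
  assumes M: "M \<in> carrier_mat d c" and rank: "mat_rank M = d"
    and y: "y \<in> carrier_vec d" and z: "M\<^sup>T *\<^sub>v y = 0\<^sub>v c"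
  shows "y = 0\<^sub>v d"
proof -
  obtain x where x: "x \<in> carrier_vec c" "M *\<^sub>v x = y"
    using full_row_rank_imp_surj[OF M rank y] by blast
  have "y \<bullet> y = 0" using transpose_mult_scalar_prod(1)[OF M x(1) y] x z by simp
  thus ?thesis by (rule scalar_prod_self_zero[OF y])
qed

lemma gram_symmetric:
  fixes M :: "real mat"
  assumes M: "M \<in> carrier_mat d c"
  shows "M * M\<^sup>T \<in> carrier_mat d d" "(M * M\<^sup>T)\<^sup>T = M * M\<^sup>T"
    "\<And>x y. x \<in> carrier_vec d \<Longrightarrow> y \<in> carrier_vec d \<Longrightarrow>
       x \<bullet> (M * M\<^sup>T *\<^sub>v y) = (M\<^sup>T *\<^sub>v x) \<bullet> (M\<^sup>T *\<^sub>v y)"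
proof -
  show "M * M\<^sup>T \<in> carrier_mat d d" using M by simp
  show "(M * M\<^sup>T)\<^sup>T = M * M\<^sup>T" using M by (simp add: transpose_mult[of M d c "M\<^sup>T" d])
  fix x y :: "real vec" assume x: "x \<in> carrier_vec d" and y: "y \<in> carrier_vec d"
  have "M * M\<^sup>T *\<^sub>v y = M *\<^sub>v (M\<^sup>T *\<^sub>v y)" using M y by simp
  thus "x \<bullet> (M * M\<^sup>T *\<^sub>v y) = (M\<^sup>T *\<^sub>v x) \<bullet> (M\<^sup>T *\<^sub>v y)"
    using transpose_mult_scalar_prod(1)[OF M, of "M\<^sup>T *\<^sub>v y" x] M x y by simp
qed

text \<open>For an eigenvector \<open>v\<close> to the smallest eigenvalue, this eigenvalue times \<open>v \<bullet> v\<close> is the squared length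
  of \<open>M\<^sup>T v\<close>, which is nonzero.\<close>

lemma full_row_rank_lambda_min_pos:
  fixes M :: "real mat"
  assumes M: "M \<in> carrier_mat d c" and rank: "mat_rank M = d" and d: "0 < d"
  shows "0 < lambda_min (M * M\<^sup>T)"
proof -
  note g = gram_symmetric[OF M]
  obtain v where v: "v \<in> carrier_vec d" "v \<noteq> 0\<^sub>v d" "M * M\<^sup>T *\<^sub>v v = lambda_min (M * M\<^sup>T) \<cdot>\<^sub>v v"
    using lambda_min_Rayleigh(1)[OF g(1,2) d] g(1) unfolding eigenvalue_def eigenvector_def by auto
  have "v \<bullet> v \<noteq> 0" using v scalar_prod_self_zero by blast
  hence vpos: "0 < v \<bullet> v" using scalar_prod_self_nonneg[of v] by simp
  have u: "M\<^sup>T *\<^sub>v v \<in> carrier_vec c" using M v by simp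
  have "(M\<^sup>T *\<^sub>v v) \<bullet> (M\<^sup>T *\<^sub>v v) \<noteq> 0"
    using full_row_rank_imp_transpose_inj[OF M rank v(1)] v(2) scalar_prod_self_zero[OF u] by blast
  hence "0 < (M\<^sup>T *\<^sub>v v) \<bullet> (M\<^sup>T *\<^sub>v v)" using scalar_prod_self_nonneg[of "M\<^sup>T *\<^sub>v v"] by simp
  also have "\<dots> = lambda_min (M * M\<^sup>T) * (v \<bullet> v)" using g(3)[OF v(1) v(1)] v by simp
  finally show ?thesis using vpos by (simp add: zero_less_mult_iff)
qed

section \<open>Blocks of a row paving\<close>

lemma paved_block_transpose_lower_bound:
  fixes R :: "real mat"
  assumes R: "R \<in> carrier_mat d n" and d: "0 < d"
    and \<alpha>: "0 < \<alpha>" "\<alpha> \<le> lambda_min (R * R\<^sup>T)" and y: "y \<in> carrier_vec d"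
  shows "sqrt \<alpha> * norm2 y \<le> norm2 (R\<^sup>T *\<^sub>v y)"
proof (rule power2_le_imp_le)
  note g = gram_symmetric[OF R]
  have "\<alpha> * (y \<bullet> y) \<le> lambda_min (R * R\<^sup>T) * (y \<bullet> y)"
    by (rule mult_right_mono[OF \<alpha>(2) scalar_prod_self_nonneg])
  also have "\<dots> \<le> (R\<^sup>T *\<^sub>v y) \<bullet> (R\<^sup>T *\<^sub>v y)"
    using lambda_min_Rayleigh(2)[OF g(1,2) d y] g(3)[OF y y] by simp
  finally show "(sqrt \<alpha> * norm2 y)\<^sup>2 \<le> (norm2 (R\<^sup>T *\<^sub>v y))\<^sup>2"
    using \<alpha>(1) by (simp add: power_mult_distrib norm2_power2)
qed (rule norm2_nonneg)

text \<open>The lower bound makes \<open>R\<^sup>T\<close> injective, hence \<open>R R\<^sup>\<dagger> = I\<close>. The vector \<open>u = R\<^sup>\<dagger> y\<close> lies in the row space,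
  so \<open>u = R\<^sup>T w\<close> with \<open>w\<close> no longer than \<open>norm2 u / s\<close>, and \<open>u \<bullet> u = w \<bullet> R u = w \<bullet> y\<close>.\<close>

lemma transpose_bounded_below_imp_pinv_right_inverse:
  fixes R :: "real mat"
  assumes R: "R \<in> carrier_mat d n" and s: "0 < s"
    and lower: "\<And>y. y \<in> carrier_vec d \<Longrightarrow> s * norm2 y \<le> norm2 (R\<^sup>T *\<^sub>v y)"
    and y: "y \<in> carrier_vec d"
  shows "R *\<^sub>v (pinv R *\<^sub>v y) = y" and "norm2 (pinv R *\<^sub>v y) \<le> norm2 y / s"
proof -
  note p = pinvD[OF R R]
  have Xy: "pinv R *\<^sub>v y \<in> carrier_vec n" using p(1) y by simp
  define r where "r = R *\<^sub>v (pinv R *\<^sub>v y) - y"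
  have r: "r \<in> carrier_vec d" using R Xy y by (simp add: r_def)
  have RX: "R * pinv R \<in> carrier_mat d d" using R p(1) by simp
  have "R\<^sup>T * (R * pinv R) = R\<^sup>T"
    using transpose_mult[OF RX R] unfolding p(4) p(2) by (rule sym)
  hence "R\<^sup>T *\<^sub>v (R *\<^sub>v (pinv R *\<^sub>v y)) = R\<^sup>T *\<^sub>v y"
    using assoc_mult_mat_vec[of "R\<^sup>T" n d "R * pinv R" d y] assoc_mult_mat_vec[OF R p(1) y] RX R y
    by simp
  hence "R\<^sup>T *\<^sub>v r = 0\<^sub>v n"
    using R Xy y by (simp add: r_def mult_minus_distrib_mat_vec[of _ n d])
  hence "norm2 r \<le> 0" using lower[OF r] s by (simp add: mult_le_0_iff)
  hence "r \<bullet> r = 0" using norm2_power2[of r] norm2_nonneg[of r] by simp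
  hence "r = 0\<^sub>v d" by (rule scalar_prod_self_zero[OF r])
  hence "(R *\<^sub>v (pinv R *\<^sub>v y) - y) $ l = 0" if "l < d" for l using that by (simp add: r_def)
  thus Ry: "R *\<^sub>v (pinv R *\<^sub>v y) = y"
    using R Xy y by (intro eq_vecI) auto
  define u where "u = pinv R *\<^sub>v y"
  define w where "w = (pinv R)\<^sup>T *\<^sub>v u"
  have u: "u \<in> carrier_vec n" and w: "w \<in> carrier_vec d" using Xy p(1) by (auto simp: u_def w_def)
  have "row_projector R *\<^sub>v u = u"
    using assoc_mult_mat_vec[OF row_projector(1)[OF R] p(1) y] row_projector(4)[OF R]
    by (simp add: u_def)
  hence uw: "u = R\<^sup>T *\<^sub>v w"
    using row_projector(6)[OF R] assoc_mult_mat_vec[of "R\<^sup>T" n d "(pinv R)\<^sup>T" n u] R p(1) u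
    by (simp add: w_def)
  have "u \<bullet> u = w \<bullet> (R *\<^sub>v u)"
    using transpose_mult_scalar_prod(1)[OF R u w] unfolding uw[symmetric] .
  also have "\<dots> = w \<bullet> y" using Ry by (simp add: u_def)
  also have "\<dots> \<le> norm2 w * norm2 y" by (rule scalar_prod_le_norm2[OF w y])
  also have "\<dots> \<le> (norm2 u / s) * norm2 y"
    using lower[OF w] s unfolding uw[symmetric]
    by (intro mult_right_mono norm2_nonneg) (simp add: pos_le_divide_eq mult.commute)
  finally show "norm2 (pinv R *\<^sub>v y) \<le> norm2 y / s"
    using s norm2_nonneg[of y] by (intro norm2_le_of_self_prod) (simp_all add: u_def)
qed

lemma vec_block_carrier: "vec_block v I \<in> carrier_vec (card {i. i < dim_vec v \<and> i \<in> I})"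
  by (simp add: vec_block_def)

lemma row_block_carrier:
  assumes "M \<in> carrier_mat m n"
  shows "row_block M I \<in> carrier_mat (card {i. i < m \<and> i \<in> I}) n"
  using assms by (auto simp: row_block_def dim_submatrix)

lemma col_block_carrier:
  assumes "M \<in> carrier_mat m n"
  shows "col_block M J \<in> carrier_mat m (card {j. j < n \<and> j \<in> J})"
  using assms by (auto simp: col_block_def dim_submatrix)

lemma row_block_mult_vec:
  assumes M: "M \<in> carrier_mat m n" and v: "v \<in> carrier_vec n"
  shows "row_block M I *\<^sub>v v = vec_block (M *\<^sub>v v) I"
proof (rule eq_vecI)
  note R = row_block_carrier[OF M, of I]
  show "dim_vec (row_block M I *\<^sub>v v) = dim_vec (vec_block (M *\<^sub>v v) I)"
    using R M by (simp add: vec_block_def)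
  fix a assume "a < dim_vec (vec_block (M *\<^sub>v v) I)"
  hence a: "a < card {i. i < m \<and> i \<in> I}" using M by (simp add: vec_block_def)
  have pa: "pick I a < m" by (rule pick_le[OF a])
  have "row (row_block M I) a = row M (pick I a)"
    using a R M pa by (intro eq_vecI) (auto simp: row_block_def submatrix_index pick_UNIV)
  thus "(row_block M I *\<^sub>v v) $ a = vec_block (M *\<^sub>v v) I $ a"
    using a R M pa by (simp add: vec_block_def)
qed

text \<open>A block selects distinct entries of the vector, because \<open>pick\<close> enumerates the index set increasingly.\<close>

lemma norm2_vec_block_le:
  "norm2 (vec_block v I) \<le> norm2 v"
proof -
  let ?c = "card {i. i < dim_vec v \<and> i \<in> I}"
  have lt: "pick I a < dim_vec v" if "a < ?c" for a using that by (rule pick_le)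
  have inj: "inj_on (pick I) {..<?c}"
  proof (rule strict_mono_on_imp_inj_on, rule strict_mono_onI)
    fix a b assume ab: "a \<in> {..<?c}" "b \<in> {..<?c}" "a < b"
    have "b < card I" if "finite I"
    proof -
      have "?c \<le> card I" using that by (intro card_mono) auto
      thus ?thesis using ab by simp
    qed
    thus "pick I a < pick I b"
      using ab(3) by (cases "finite I") (auto intro: pick_mono_le pick_mono_inf)
  qed
  have "vec_block v I \<bullet> vec_block v I = (\<Sum>a<?c. (v $ pick I a)\<^sup>2)"
    unfolding scalar_prod_def by (simp add: vec_block_def power2_eq_square atLeast0LessThan)
  also have "\<dots> = (\<Sum>l\<in>pick I ` {..<?c}. (v $ l)\<^sup>2)" using inj by (simp add: sum.reindex)
  also have "\<dots> \<le> (\<Sum>l<dim_vec v. (v $ l)\<^sup>2)" using lt by (intro sum_mono2) auto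
  also have "\<dots> = v \<bullet> v" unfolding scalar_prod_def by (simp add: power2_eq_square atLeast0LessThan)
  finally show ?thesis by (simp add: norm2_def)
qed

section \<open>The row space projector from a singular value decomposition\<close>

text \<open>For a block of full row rank all singular values \<open>S $$ (j, j)\<close>, \<open>j < d\<close>, are nonzero. So the first \<open>d\<close>
  columns of \<open>V\<close> are multiples of \<open>R\<^sup>T\<close> applied to columns of \<open>U\<close> and are fixed by the projector,
  while \<open>R\<close> kills the others. Parseval's identity for the orthonormal columns of \<open>V\<close> then expands the
  bilinear form of the projector.\<close>

lemma full_svd_row_projector:
  fixes R :: "real mat"
  assumes R: "R \<in> carrier_mat d n" and svd: "full_svd R U S V" and rank: "mat_rank R = d"
    and x: "x \<in> carrier_vec n" and y: "y \<in> carrier_vec n"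
  shows "x \<bullet> (row_projector R *\<^sub>v y) = (\<Sum>j<d. (x \<bullet> col V j) * (y \<bullet> col V j))"
proof -
  have U: "U \<in> carrier_mat d d" "U\<^sup>T * U = 1\<^sub>m d" and V: "V \<in> carrier_mat n n" "V\<^sup>T * V = 1\<^sub>m n" "V * V\<^sup>T = 1\<^sub>m n"
    and S: "S \<in> carrier_mat d n" "diagonal_mat S" and fac: "R = U * S * V\<^sup>T"
    using svd R unfolding full_svd_def orthonormal_mat_def by auto
  interpret vec_space "TYPE(real)" d .
  have dn: "d \<le> n" using rank_le_nc[OF R] rank R by (simp add: mat_rank_def)
  let ?P = "row_projector R"
  note P = row_projector[OF R] and p = pinvD[OF R R]
  have colV: "col V j \<in> carrier_vec n" for j using V by auto
  have VTcol: "V\<^sup>T *\<^sub>v col V j = unit_vec n j" if "j < n" for j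
  proof -
    have "V\<^sup>T *\<^sub>v col V j = col (V\<^sup>T * V) j" using col_mult2[of "V\<^sup>T" n n V n j] that V(1) by simp
    thus ?thesis using that V(2) by simp
  qed
  have UTcol: "U\<^sup>T *\<^sub>v col U j = unit_vec d j" if "j < d" for j
  proof -
    have "U\<^sup>T *\<^sub>v col U j = col (U\<^sup>T * U) j" using col_mult2[of "U\<^sup>T" d d U d j] that U(1) by simp
    thus ?thesis using that U(2) by simp
  qed
  have Rcol: "R *\<^sub>v col V j = U *\<^sub>v col S j" if j: "j < n" for j
  proof -
    have "R *\<^sub>v col V j = U * S *\<^sub>v (V\<^sup>T *\<^sub>v col V j)"
      unfolding fac using U S V colV by (intro assoc_mult_mat_vec[of _ d n _ n]) auto
    also have "\<dots> = U *\<^sub>v (S *\<^sub>v unit_vec n j)"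
      unfolding VTcol[OF j] using U S by (intro assoc_mult_mat_vec[of _ d d _ n]) auto
    also have "S *\<^sub>v unit_vec n j = col S j" using S j by (intro eq_vecI) auto
    finally show ?thesis .
  qed
  have Pcol: "?P *\<^sub>v col V j = pinv R *\<^sub>v (R *\<^sub>v col V j)" for j
    unfolding row_projector_def using p(1) R colV by (rule assoc_mult_mat_vec)
  have high: "?P *\<^sub>v col V j = 0\<^sub>v n" if j: "d \<le> j" "j < n" for j
  proof -
    have "col S j = 0\<^sub>v d" using S j by (intro eq_vecI) (auto simp: diagonal_mat_def)
    hence "R *\<^sub>v col V j = 0\<^sub>v d" using Rcol[OF j(2)] U by (intro eq_vecI) auto
    thus ?thesis unfolding Pcol using p(1) by (intro eq_vecI) auto
  qed
  have low: "?P *\<^sub>v col V j = col V j" if j: "j < d" for j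
  proof -
    have jn: "j < n" using j dn by simp
    define s where "s = S $$ (j, j)"
    have RT: "R\<^sup>T = V * (S\<^sup>T * U\<^sup>T)"
      unfolding fac using U(1) S(1) V(1) transpose_mult[of "U * S" d n "V\<^sup>T" n]
        transpose_mult[of U d d S n] by (simp del: assoc_mult_mat)
    have "R\<^sup>T *\<^sub>v col U j = V *\<^sub>v (S\<^sup>T * U\<^sup>T *\<^sub>v col U j)"
      unfolding RT using U S V j by (intro assoc_mult_mat_vec[of _ n n _ d]) auto
    also have "S\<^sup>T * U\<^sup>T *\<^sub>v col U j = S\<^sup>T *\<^sub>v unit_vec d j"
      unfolding UTcol[OF j, symmetric] using U S j by (intro assoc_mult_mat_vec[of _ n d _ d]) auto
    also have "S\<^sup>T *\<^sub>v unit_vec d j = s \<cdot>\<^sub>v unit_vec n j"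
      using S j jn by (intro eq_vecI) (auto simp: diagonal_mat_def s_def)
    also have "V *\<^sub>v (s \<cdot>\<^sub>v unit_vec n j) = s \<cdot>\<^sub>v col V j"
      using V jn by (intro eq_vecI) (auto simp: mult_mat_vec[of _ n n])
    finally have RTu: "R\<^sup>T *\<^sub>v col U j = s \<cdot>\<^sub>v col V j" .
    have colU: "col U j \<in> carrier_vec d" using U by auto
    have "s \<noteq> 0"
    proof
      assume "s = 0"
      hence "R\<^sup>T *\<^sub>v col U j = 0\<^sub>v n" unfolding RTu using V by (intro eq_vecI) auto
      hence "col U j = 0\<^sub>v d" by (rule full_row_rank_imp_transpose_inj[OF R rank colU])
      hence "U\<^sup>T *\<^sub>v col U j = 0\<^sub>v d" using U by (intro eq_vecI) auto
      hence "unit_vec d j $ j = (0\<^sub>v d :: real vec) $ j" using UTcol[OF j] by simp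
      thus False using j by simp
    qed
    hence v: "col V j = (1 / s) \<cdot>\<^sub>v (R\<^sup>T *\<^sub>v col U j)"
      unfolding RTu using V by (intro eq_vecI) auto
    have "?P *\<^sub>v (R\<^sup>T *\<^sub>v col U j) = R\<^sup>T *\<^sub>v col U j"
      using assoc_mult_mat_vec[OF P(1), of "R\<^sup>T" d "col U j"] R colU P(5) by simp
    thus ?thesis
      unfolding v using R colU by (subst mult_mat_vec[OF P(1)]) auto
  qed
  define u where "u = ?P *\<^sub>v x"
  have u: "u \<in> carrier_vec n" using P(1) x by (simp add: u_def)
  have uc: "u \<bullet> col V j = (if j < d then x \<bullet> col V j else 0)" if "j < n" for j
  proof -
    have "u \<bullet> col V j = x \<bullet> (?P *\<^sub>v col V j)"
      unfolding u_def using transpose_mult_scalar_prod(2)[OF P(1) x colV] P(2) by simp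
    thus ?thesis using low high that x by simp
  qed
  have "x \<bullet> (?P *\<^sub>v y) = u \<bullet> y"
    unfolding u_def using transpose_mult_scalar_prod(2)[OF P(1) x y] P(2) by simp
  also have "\<dots> = u \<bullet> (V * V\<^sup>T *\<^sub>v y)" using V(3) y by simp
  also have "\<dots> = (V\<^sup>T *\<^sub>v u) \<bullet> (V\<^sup>T *\<^sub>v y)" by (rule gram_symmetric(3)[OF V(1) u y])
  also have "\<dots> = (\<Sum>j<n. (u \<bullet> col V j) * (y \<bullet> col V j))"
    using V u y colV unfolding scalar_prod_def[of "V\<^sup>T *\<^sub>v u"]
    by (auto intro!: sum.cong simp: atLeast0LessThan comm_scalar_prod[of u n] comm_scalar_prod[of y n])
  also have "\<dots> = (\<Sum>j<d. (u \<bullet> col V j) * (y \<bullet> col V j))"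
    using dn uc by (intro sum.mono_neutral_right) auto
  also have "\<dots> = (\<Sum>j<d. (x \<bullet> col V j) * (y \<bullet> col V j))"
    using dn uc by (intro sum.cong) auto
  finally show ?thesis .
qed

lemma mat_of_cols_gram_form:
  assumes cs: "set cs \<subseteq> carrier_vec n" and x: "x \<in> carrier_vec n" and y: "y \<in> carrier_vec n"
  shows "((mat_of_cols n cs)\<^sup>T *\<^sub>v x) \<bullet> ((mat_of_cols n cs)\<^sup>T *\<^sub>v y)
    = (\<Sum>c\<leftarrow>cs. (x \<bullet> c) * (y \<bullet> (c :: real vec)))"
proof -
  have c: "cs ! l \<in> carrier_vec n" if "l < length cs" for l using cs that by auto
  have "((mat_of_cols n cs)\<^sup>T *\<^sub>v x) \<bullet> ((mat_of_cols n cs)\<^sup>T *\<^sub>v y)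
      = (\<Sum>l<length cs. (x \<bullet> cs ! l) * (y \<bullet> cs ! l))"
    unfolding scalar_prod_def[of "(mat_of_cols n cs)\<^sup>T *\<^sub>v x"]
    using c x y by (auto intro!: sum.cong simp: atLeast0LessThan
        comm_scalar_prod[of x n] comm_scalar_prod[of y n])
  thus ?thesis by (simp add: sum_list_sum_nth atLeast0LessThan)
qed

text \<open>The columns of the weighted basis are grouped by blocks, and each scaling factor enters its Gram
  matrix squared, which turns the Frobenius norms into the drawing probabilities. Combined with
  \<open>full_svd_row_projector\<close> this identifies the Gram matrix with the mean of the projectors.\<close>

lemma weighted_row_basis_form:
  assumes M: "M \<in> carrier_mat m n" and V: "\<And>s. s < p \<Longrightarrow> V s \<in> carrier_mat n n"
    and rank: "\<And>s. s < p \<Longrightarrow> mat_rank (row_block M (\<tau> s)) = r s" and rn: "\<And>s. s < p \<Longrightarrow> r s \<le> n"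
    and x: "x \<in> carrier_vec n" and y: "y \<in> carrier_vec n"
  defines "B \<equiv> weighted_row_basis M p \<tau> V"
  shows "x \<bullet> (B * B\<^sup>T *\<^sub>v y) = (\<Sum>s<p. (frob_norm (row_block M (\<tau> s)))\<^sup>2 / (frob_norm M)\<^sup>2
      * (\<Sum>j<r s. (x \<bullet> col (V s) j) * (y \<bullet> col (V s) j)))"
proof -
  define bs where "bs = (\<lambda>s. cols (frob_norm (row_block M (\<tau> s)) \<cdot>\<^sub>m leading_cols (r s) (V s)))"
  define cs where "cs = concat (map bs [0..<p])"
  let ?f = "1 / frob_norm M"
  have bs_eq: "bs s = map (\<lambda>j. frob_norm (row_block M (\<tau> s)) \<cdot>\<^sub>v col (V s) j) [0..<r s]" if s: "s < p" for s
  proof (rule nth_equalityI)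
    have len: "length (take (r s) (cols (V s))) = r s" using V[OF s] rn[OF s] by simp
    show l: "length (bs s) = length (map (\<lambda>j. frob_norm (row_block M (\<tau> s)) \<cdot>\<^sub>v col (V s) j) [0..<r s])"
      using len by (simp add: bs_def leading_cols_def)
    fix l assume "l < length (bs s)"
    hence lr: "l < r s" using l by simp
    have "col (leading_cols (r s) (V s)) l = col (V s) l"
      unfolding leading_cols_def using lr len V[OF s] rn[OF s] by (subst col_mat_of_cols) auto
    thus "bs s ! l = map (\<lambda>j. frob_norm (row_block M (\<tau> s)) \<cdot>\<^sub>v col (V s) j) [0..<r s] ! l"
      using lr len by (simp add: bs_def leading_cols_def)
  qed
  have "map bs [0..<p] = map (\<lambda>s. cols (frob_norm (row_block M (\<tau> s)) \<cdot>\<^sub>m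
      leading_cols (mat_rank (row_block M (\<tau> s))) (V s))) [0..<p]"
    using rank by (simp add: bs_def)
  moreover have "dim_col M = n" using M by simp
  ultimately have B_eq: "B = ?f \<cdot>\<^sub>m mat_of_cols n cs"
    unfolding B_def weighted_row_basis_def cs_def by (simp only:)
  have csc: "set cs \<subseteq> carrier_vec n" unfolding cs_def using bs_eq V by fastforce
  let ?C = "mat_of_cols n cs"
  have C: "?C \<in> carrier_mat n (length cs)" by simp
  have B: "B \<in> carrier_mat n (length cs)" by (simp add: B_eq)
  have BT: "B\<^sup>T *\<^sub>v z = ?f \<cdot>\<^sub>v (?C\<^sup>T *\<^sub>v z)" if "z \<in> carrier_vec n" for z
    unfolding B_eq using that C by (intro eq_vecI) auto
  have "x \<bullet> (B * B\<^sup>T *\<^sub>v y) = (?f \<cdot>\<^sub>v (?C\<^sup>T *\<^sub>v x)) \<bullet> (?f \<cdot>\<^sub>v (?C\<^sup>T *\<^sub>v y))"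
    using gram_symmetric(3)[OF B x y] BT[OF x] BT[OF y] by simp
  also have "\<dots> = ?f\<^sup>2 * ((?C\<^sup>T *\<^sub>v x) \<bullet> (?C\<^sup>T *\<^sub>v y))"
    by (simp add: power2_eq_square)
  also have "\<dots> = ?f\<^sup>2 * (\<Sum>c\<leftarrow>cs. (x \<bullet> c) * (y \<bullet> c))"
    by (simp only: mat_of_cols_gram_form[OF csc x y])
  also have "(\<Sum>c\<leftarrow>cs. (x \<bullet> c) * (y \<bullet> c)) = (\<Sum>s<p. \<Sum>c\<leftarrow>bs s. (x \<bullet> c) * (y \<bullet> c))"
    unfolding cs_def by (induction p) simp_all
  also have "\<dots> = (\<Sum>s<p. (frob_norm (row_block M (\<tau> s)))\<^sup>2 * (\<Sum>j<r s. (x \<bullet> col (V s) j) * (y \<bullet> col (V s) j)))"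
  proof (rule sum.cong[OF refl])
    fix s assume "s \<in> {..<p}"
    hence s: "s < p" by simp
    have c: "col (V s) j \<in> carrier_vec n" for j using V[OF s] by auto
    show "(\<Sum>c\<leftarrow>bs s. (x \<bullet> c) * (y \<bullet> c)) = (frob_norm (row_block M (\<tau> s)))\<^sup>2 * (\<Sum>j<r s. (x \<bullet> col (V s) j) * (y \<bullet> col (V s) j))"
      unfolding bs_eq[OF s] using x y c
      by (simp add: comp_def interv_sum_list_conv_sum_set_nat atLeast0LessThan
          scalar_prod_smult_distrib[of _ n] sum_distrib_left power2_eq_square mult_ac)
  qed
  finally show ?thesis by (simp add: sum_distrib_left power_divide)
qed

section \<open>Contraction by a convex combination of projectors\<close>

text \<open>The matrix \<open>B = I - W\<close> satisfies \<open>0 \<le> v \<bullet> B v \<le> (1 - \<eta>) (v \<bullet> v)\<close>. The Cauchy-Schwarz inequality for the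
  form \<open>B\<close>, applied to \<open>B v\<close> and \<open>v\<close>, turns this bound on the form into a bound on the operator norm
  of \<open>B\<close>.\<close>

lemma residual_contraction:
  fixes W :: "real mat"
  assumes W: "W \<in> carrier_mat n n" and sym: "W\<^sup>T = W" and n: "0 < n"
    and le1: "\<And>v. v \<in> carrier_vec n \<Longrightarrow> v \<bullet> (W *\<^sub>v v) \<le> v \<bullet> v"
  shows "lambda_min W \<le> 1"
    and "\<And>v. v \<in> carrier_vec n \<Longrightarrow> norm2 (v - W *\<^sub>v v) \<le> (1 - lambda_min W) * norm2 v"
proof -
  define \<eta> where "\<eta> = lambda_min W"
  note ray = lambda_min_Rayleigh(2)[OF W sym n, folded \<eta>_def]
  have "\<eta> * (unit_vec n 0 \<bullet> unit_vec n 0) \<le> unit_vec n 0 \<bullet> (unit_vec n 0 :: real vec)"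
    by (rule order_trans[OF ray le1]) auto
  hence \<eta>1: "\<eta> \<le> 1" using n by simp
  thus "lambda_min W \<le> 1" by (simp add: \<eta>_def)
  define B where "B = 1\<^sub>m n - W"
  have B: "B \<in> carrier_mat n n" unfolding B_def by (rule minus_carrier_mat[OF W])
  have Bsym: "B\<^sup>T = B" using W sym by (simp add: B_def transpose_minus[of _ n n])
  have Bv: "B *\<^sub>v v = v - W *\<^sub>v v" if "v \<in> carrier_vec n" for v
    using that W by (simp add: B_def minus_mult_distrib_mat_vec[of _ n n])
  have form: "v \<bullet> (B *\<^sub>v v) = v \<bullet> v - v \<bullet> (W *\<^sub>v v)" if "v \<in> carrier_vec n" for v
    using that W by (simp add: Bv scalar_prod_minus_distrib[of _ n])
  have psd: "0 \<le> v \<bullet> (B *\<^sub>v v)" if "v \<in> carrier_vec n" for v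
    using form[OF that] le1[OF that] by simp
  have upper: "v \<bullet> (B *\<^sub>v v) \<le> (1 - \<eta>) * (v \<bullet> v)" if "v \<in> carrier_vec n" for v
    using form[OF that] ray[OF that] by (simp add: algebra_simps)
  fix v :: "real vec" assume v: "v \<in> carrier_vec n"
  define u where "u = B *\<^sub>v v"
  have u: "u \<in> carrier_vec n" using B v by (simp add: u_def)
  have "norm2 u \<le> (1 - \<eta>) * norm2 v"
  proof (rule norm2_le_of_self_prod)
    show "u \<bullet> u \<le> norm2 u * ((1 - \<eta>) * norm2 v)"
    proof (rule power2_le_imp_le)
      have "(u \<bullet> u)\<^sup>2 \<le> (u \<bullet> (B *\<^sub>v u)) * (v \<bullet> (B *\<^sub>v v))"
        using psd_form_Cauchy_Schwarz[OF B Bsym psd u v] by (simp add: u_def)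
      also have "\<dots> \<le> ((1 - \<eta>) * (u \<bullet> u)) * ((1 - \<eta>) * (v \<bullet> v))"
        using upper[OF u] upper[OF v] psd[OF u] psd[OF v] \<eta>1 scalar_prod_self_nonneg
        by (intro mult_mono) auto
      also have "\<dots> = (norm2 u * ((1 - \<eta>) * norm2 v))\<^sup>2"
        unfolding power_mult_distrib norm2_power2 by (simp add: power2_eq_square)
      finally show "(u \<bullet> u)\<^sup>2 \<le> (norm2 u * ((1 - \<eta>) * norm2 v))\<^sup>2" .
    qed (use \<eta>1 norm2_nonneg in simp)
  qed (use \<eta>1 norm2_nonneg in simp)
  thus "norm2 (v - W *\<^sub>v v) \<le> (1 - lambda_min W) * norm2 v"
    using Bv[OF v] by (simp add: u_def \<eta>_def)
qed

definition mean_vec :: "nat \<Rightarrow> nat \<Rightarrow> (nat \<Rightarrow> real) \<Rightarrow> (nat \<Rightarrow> real vec) \<Rightarrow> real vec" where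
  "mean_vec n p w D = vec n (\<lambda>l. \<Sum>s<p. w s * D s $ l)"

lemma mean_vec_carrier [simp]: "mean_vec n p w D \<in> carrier_vec n"
  by (simp add: mean_vec_def)

lemma scalar_prod_mean_vec:
  assumes u: "u \<in> carrier_vec n" and D: "\<And>s. s < p \<Longrightarrow> D s \<in> carrier_vec n"
  shows "u \<bullet> mean_vec n p w D = (\<Sum>s<p. w s * (u \<bullet> D s))"
proof -
  have "u \<bullet> mean_vec n p w D = (\<Sum>l<n. \<Sum>s<p. w s * (u $ l * D s $ l))"
    unfolding scalar_prod_def mean_vec_def
    by (simp add: atLeast0LessThan sum_distrib_left mult_ac)
  also have "\<dots> = (\<Sum>s<p. \<Sum>l<n. w s * (u $ l * D s $ l))" by (rule sum.swap)
  also have "\<dots> = (\<Sum>s<p. w s * (u \<bullet> D s))"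
  proof (rule sum.cong[OF refl])
    fix s assume "s \<in> {..<p}"
    hence "dim_vec (D s) = n" using D by auto
    thus "(\<Sum>l<n. w s * (u $ l * D s $ l)) = w s * (u \<bullet> D s)"
      by (simp add: scalar_prod_def sum_distrib_left atLeast0LessThan)
  qed
  finally show ?thesis .
qed

text \<open>One step of the recursion for the expected error, freed from probability: \<open>g s\<close> collects the noise
  terms of block \<open>s\<close>, and averaging \<open>e - P s e\<close> over the blocks gives \<open>e - W e\<close>.\<close>

lemma mean_projected_step_bound:
  assumes n: "0 < n" and W: "W \<in> carrier_mat n n" "W\<^sup>T = W"
    and P: "\<And>s. s < p \<Longrightarrow> P s \<in> carrier_mat n n" "\<And>s. s < p \<Longrightarrow> (P s)\<^sup>T = P s"
      "\<And>s. s < p \<Longrightarrow> P s * P s = P s"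
    and w: "\<And>s. s < p \<Longrightarrow> 0 \<le> w s" "(\<Sum>s<p. w s) = (1 :: real)"
    and form: "\<And>x y. x \<in> carrier_vec n \<Longrightarrow> y \<in> carrier_vec n \<Longrightarrow>
      x \<bullet> (W *\<^sub>v y) = (\<Sum>s<p. w s * (x \<bullet> (P s *\<^sub>v y)))"
    and e: "e \<in> carrier_vec n"
    and g: "\<And>s. s < p \<Longrightarrow> g s \<in> carrier_vec n" "\<And>s. s < p \<Longrightarrow> norm2 (g s) \<le> C"
  shows "lambda_min W \<le> 1"
    and "0 \<le> C"
    and "norm2 (mean_vec n p w (\<lambda>s. e - P s *\<^sub>v e + g s)) \<le> (1 - lambda_min W) * norm2 e + C"
proof -
  have le1: "v \<bullet> (W *\<^sub>v v) \<le> v \<bullet> v" if v: "v \<in> carrier_vec n" for v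
  proof -
    have "v \<bullet> (W *\<^sub>v v) \<le> (\<Sum>s<p. w s * (v \<bullet> v))"
      unfolding form[OF v v] using w(1)
      by (intro sum_mono mult_left_mono symmetric_idempotent_contracts(3)[OF P v]) auto
    thus ?thesis using w(2) by (simp add: sum_distrib_right[symmetric])
  qed
  have con: "lambda_min W \<le> 1" "norm2 (e - W *\<^sub>v e) \<le> (1 - lambda_min W) * norm2 e"
    by (rule residual_contraction[OF W n]; use le1 e in blast)+
  show "lambda_min W \<le> 1" by (rule con(1))
  have "p \<noteq> 0" using w(2) by (cases p) auto
  thus C0: "0 \<le> C" using order_trans[OF norm2_nonneg g(2)[of 0]] by simp
  define u where "u = mean_vec n p w (\<lambda>s. e - P s *\<^sub>v e + g s)"
  have u: "u \<in> carrier_vec n" by (simp add: u_def)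
  have We: "W *\<^sub>v e \<in> carrier_vec n" using W e by simp
  have "u \<bullet> u = (\<Sum>s<p. w s * (u \<bullet> (e - P s *\<^sub>v e + g s)))"
    unfolding u_def
    by (rule scalar_prod_mean_vec) (use e mult_mat_vec_carrier[OF P(1) e] g(1) in auto)
  also have "\<dots> = (\<Sum>s<p. w s * (u \<bullet> e) - w s * (u \<bullet> (P s *\<^sub>v e)) + w s * (u \<bullet> g s))"
  proof (rule sum.cong[OF refl])
    fix s assume "s \<in> {..<p}"
    hence s: "s < p" by simp
    have Pe: "P s *\<^sub>v e \<in> carrier_vec n" using P(1)[OF s] e by simp
    show "w s * (u \<bullet> (e - P s *\<^sub>v e + g s)) = w s * (u \<bullet> e) - w s * (u \<bullet> (P s *\<^sub>v e)) + w s * (u \<bullet> g s)"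
      using u e Pe g(1)[OF s]
      by (simp add: scalar_prod_add_distrib[of _ n] scalar_prod_minus_distrib[of _ n] algebra_simps)
  qed
  also have "\<dots> = u \<bullet> (e - W *\<^sub>v e) + (\<Sum>s<p. w s * (u \<bullet> g s))"
    using u e We w(2) form[OF u e]
    by (simp add: sum.distrib sum_subtractf sum_distrib_right[symmetric] scalar_prod_minus_distrib[of _ n])
  also have "\<dots> \<le> norm2 u * norm2 (e - W *\<^sub>v e) + (\<Sum>s<p. w s * (norm2 u * C))"
  proof (intro add_mono sum_mono mult_left_mono)
    show "u \<bullet> (e - W *\<^sub>v e) \<le> norm2 u * norm2 (e - W *\<^sub>v e)"
      using e We by (intro scalar_prod_le_norm2[OF u]) auto
    fix s assume "s \<in> {..<p}"
    hence s: "s < p" by simp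
    have "u \<bullet> g s \<le> norm2 u * norm2 (g s)" by (rule scalar_prod_le_norm2[OF u g(1)[OF s]])
    also have "\<dots> \<le> norm2 u * C" by (rule mult_left_mono[OF g(2)[OF s] norm2_nonneg])
    finally show "u \<bullet> g s \<le> norm2 u * C" .
    show "0 \<le> w s" by (rule w(1)[OF s])
  qed
  also have "\<dots> \<le> norm2 u * ((1 - lambda_min W) * norm2 e) + norm2 u * C"
    using mult_left_mono[OF con(2) norm2_nonneg[of u]] w(2)
    by (simp add: sum_distrib_right[symmetric])
  finally have "u \<bullet> u \<le> norm2 u * ((1 - lambda_min W) * norm2 e + C)"
    by (simp add: algebra_simps)
  thus "norm2 (mean_vec n p w (\<lambda>s. e - P s *\<^sub>v e + g s)) \<le> (1 - lambda_min W) * norm2 e + C"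
    unfolding u_def using C0 con(1) norm2_nonneg[of e] by (intro norm2_le_of_self_prod) auto
qed

section \<open>Expected vectors\<close>

definition integrable_vec :: "'w measure \<Rightarrow> nat \<Rightarrow> ('w \<Rightarrow> real vec) \<Rightarrow> bool" where
  "integrable_vec P d X \<longleftrightarrow>
     (\<forall>\<omega>\<in>space P. X \<omega> \<in> carrier_vec d) \<and> (\<forall>l<d. integrable P (\<lambda>\<omega>. X \<omega> $ l))"

lemma expect_vec_carrier [simp]: "expect_vec P d X \<in> carrier_vec d"
  by (simp add: expect_vec_def)

lemma expect_vec_mult_mat:
  assumes A: "A \<in> carrier_mat r d" and X: "integrable_vec P d X"
  shows "integrable_vec P r (\<lambda>\<omega>. A *\<^sub>v X \<omega>)"
    and "expect_vec P r (\<lambda>\<omega>. A *\<^sub>v X \<omega>) = A *\<^sub>v expect_vec P d X"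
proof -
  have entry: "(A *\<^sub>v X \<omega>) $ a = (\<Sum>l<d. A $$ (a, l) * X \<omega> $ l)" if "\<omega> \<in> space P" "a < r" for \<omega> a
    using A X that by (auto simp: integrable_vec_def scalar_prod_def atLeast0LessThan intro!: sum.cong)
  have int: "integrable P (\<lambda>\<omega>. \<Sum>l<d. A $$ (a, l) * X \<omega> $ l)" for a
    using X by (auto simp: integrable_vec_def)
  show "integrable_vec P r (\<lambda>\<omega>. A *\<^sub>v X \<omega>)"
    unfolding integrable_vec_def
  proof (intro conjI ballI allI impI)
    fix \<omega> assume "\<omega> \<in> space P"
    thus "A *\<^sub>v X \<omega> \<in> carrier_vec r" using A X by (auto simp: integrable_vec_def)
  next
    fix a assume "a < r"
    thus "integrable P (\<lambda>\<omega>. (A *\<^sub>v X \<omega>) $ a)"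
      using int[of a] entry by (subst Bochner_Integration.integrable_cong[OF refl]) auto
  qed
  show "expect_vec P r (\<lambda>\<omega>. A *\<^sub>v X \<omega>) = A *\<^sub>v expect_vec P d X"
  proof (rule eq_vecI)
    fix a assume "a < dim_vec (A *\<^sub>v expect_vec P d X)"
    hence a: "a < r" using A by simp
    have "(\<integral>\<omega>. (A *\<^sub>v X \<omega>) $ a \<partial>P) = (\<integral>\<omega>. (\<Sum>l<d. A $$ (a, l) * X \<omega> $ l) \<partial>P)"
      using entry a by (intro Bochner_Integration.integral_cong) auto
    also have "\<dots> = (\<Sum>l<d. A $$ (a, l) * (\<integral>\<omega>. X \<omega> $ l \<partial>P))"
      using X by (subst Bochner_Integration.integral_sum) (auto simp: integrable_vec_def)
    also have "\<dots> = (A *\<^sub>v expect_vec P d X) $ a"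
      using A a by (auto simp: expect_vec_def scalar_prod_def atLeast0LessThan intro!: sum.cong)
    finally show "expect_vec P r (\<lambda>\<omega>. A *\<^sub>v X \<omega>) $ a = (A *\<^sub>v expect_vec P d X) $ a"
      using a by (simp add: expect_vec_def)
  qed (use A in \<open>simp add: expect_vec_def\<close>)
qed

lemma expect_vec_add:
  assumes X: "integrable_vec P d X" and Y: "integrable_vec P d Y"
  shows "integrable_vec P d (\<lambda>\<omega>. X \<omega> + Y \<omega>)"
    and "expect_vec P d (\<lambda>\<omega>. X \<omega> + Y \<omega>) = expect_vec P d X + expect_vec P d Y"
proof -
  have entry: "(X \<omega> + Y \<omega>) $ l = X \<omega> $ l + Y \<omega> $ l" if "\<omega> \<in> space P" "l < d" for \<omega> l
    using X Y that by (auto simp: integrable_vec_def)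
  show "integrable_vec P d (\<lambda>\<omega>. X \<omega> + Y \<omega>)"
    unfolding integrable_vec_def
  proof (intro conjI ballI allI impI)
    fix \<omega> assume "\<omega> \<in> space P"
    thus "X \<omega> + Y \<omega> \<in> carrier_vec d" using X Y by (auto simp: integrable_vec_def)
  next
    fix l assume l: "l < d"
    have "integrable P (\<lambda>\<omega>. X \<omega> $ l + Y \<omega> $ l)" using X Y l by (auto simp: integrable_vec_def)
    thus "integrable P (\<lambda>\<omega>. (X \<omega> + Y \<omega>) $ l)"
      using entry l by (subst Bochner_Integration.integrable_cong[OF refl]) auto
  qed
  show "expect_vec P d (\<lambda>\<omega>. X \<omega> + Y \<omega>) = expect_vec P d X + expect_vec P d Y"
  proof (rule eq_vecI)
    fix l assume "l < dim_vec (expect_vec P d X + expect_vec P d Y)"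
    hence l: "l < d" by (simp add: expect_vec_def)
    have "(\<integral>\<omega>. (X \<omega> + Y \<omega>) $ l \<partial>P) = (\<integral>\<omega>. X \<omega> $ l + Y \<omega> $ l \<partial>P)"
      using entry l by (intro Bochner_Integration.integral_cong) auto
    also have "\<dots> = (\<integral>\<omega>. X \<omega> $ l \<partial>P) + (\<integral>\<omega>. Y \<omega> $ l \<partial>P)"
      using X Y l by (intro Bochner_Integration.integral_add) (auto simp: integrable_vec_def)
    finally show "expect_vec P d (\<lambda>\<omega>. X \<omega> + Y \<omega>) $ l = (expect_vec P d X + expect_vec P d Y) $ l"
      using l by (simp add: expect_vec_def)
  qed (simp add: expect_vec_def)
qed

lemma (in prob_space) expect_vec_const:
  assumes "c \<in> carrier_vec d"
  shows "integrable_vec M d (\<lambda>\<omega>. c)" and "expect_vec M d (\<lambda>\<omega>. c) = c"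
  using assms by (auto simp: integrable_vec_def expect_vec_def prob_space intro!: eq_vecI)

lemma expect_vec_block:
  assumes X: "\<And>\<omega>. \<omega> \<in> space P \<Longrightarrow> X \<omega> \<in> carrier_vec d"
  shows "expect_vec P (card {i. i < d \<and> i \<in> I}) (\<lambda>\<omega>. vec_block (X \<omega>) I) = vec_block (expect_vec P d X) I"
proof (rule eq_vecI)
  fix a assume "a < dim_vec (vec_block (expect_vec P d X) I)"
  hence a: "a < card {i. i < d \<and> i \<in> I}" by (simp add: vec_block_def expect_vec_def)
  have "(\<integral>\<omega>. vec_block (X \<omega>) I $ a \<partial>P) = (\<integral>\<omega>. X \<omega> $ pick I a \<partial>P)"
  proof (rule Bochner_Integration.integral_cong[OF refl])
    fix \<omega> assume "\<omega> \<in> space P"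
    hence "dim_vec (X \<omega>) = d" using X by auto
    thus "vec_block (X \<omega>) I $ a = X \<omega> $ pick I a" using a by (simp add: vec_block_def)
  qed
  thus "expect_vec P (card {i. i < d \<and> i \<in> I}) (\<lambda>\<omega>. vec_block (X \<omega>) I) $ a = vec_block (expect_vec P d X) I $ a"
    using a pick_le[OF a] by (simp add: expect_vec_def vec_block_def)
qed (simp add: vec_block_def expect_vec_def)

lemma integrable_vec_block:
  assumes X: "integrable_vec P d X"
  shows "integrable_vec P (card {i. i < d \<and> i \<in> I}) (\<lambda>\<omega>. vec_block (X \<omega>) I)"
  unfolding integrable_vec_def
proof (intro conjI ballI allI impI)
  fix \<omega> assume "\<omega> \<in> space P"
  hence "dim_vec (X \<omega>) = d" using X by (auto simp: integrable_vec_def)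
  thus "vec_block (X \<omega>) I \<in> carrier_vec (card {i. i < d \<and> i \<in> I})"
    using vec_block_carrier[of "X \<omega>" I] by simp
next
  fix a assume a: "a < card {i. i < d \<and> i \<in> I}"
  have "vec_block (X \<omega>) I $ a = X \<omega> $ pick I a" if "\<omega> \<in> space P" for \<omega>
  proof -
    have "dim_vec (X \<omega>) = d" using X that by (auto simp: integrable_vec_def)
    thus ?thesis using a by (simp add: vec_block_def)
  qed
  moreover have "integrable P (\<lambda>\<omega>. X \<omega> $ pick I a)"
    using X pick_le[OF a] by (simp add: integrable_vec_def)
  ultimately show "integrable P (\<lambda>\<omega>. vec_block (X \<omega>) I $ a)"
    by (subst Bochner_Integration.integrable_cong[OF refl]) auto
qed

text \<open>Jensen's inequality for the norm, by testing the mean \<open>\<mu>\<close> against itself: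
  \<open>\<mu> \<bullet> \<mu>\<close> is the expectation of \<open>\<mu> \<bullet> X\<close>.\<close>

lemma (in prob_space) norm2_expect_vec_le:
  assumes X: "integrable_vec M d X" and bound: "\<And>\<omega>. \<omega> \<in> space M \<Longrightarrow> norm2 (X \<omega>) \<le> c"
  shows "norm2 (expect_vec M d X) \<le> c"
proof -
  define \<mu> where "\<mu> = expect_vec M d X"
  have \<mu>: "\<mu> \<in> carrier_vec d" by (simp add: \<mu>_def)
  have c0: "0 \<le> c"
    using not_empty order_trans[OF norm2_nonneg bound] by blast
  have int: "integrable M (\<lambda>\<omega>. \<Sum>l<d. \<mu> $ l * X \<omega> $ l)"
    using X by (auto simp: integrable_vec_def)
  have "\<mu> \<bullet> \<mu> = (\<Sum>l<d. \<mu> $ l * (\<integral>\<omega>. X \<omega> $ l \<partial>M))"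
    unfolding scalar_prod_def using \<mu> by (auto simp: \<mu>_def expect_vec_def atLeast0LessThan)
  also have "\<dots> = (\<integral>\<omega>. (\<Sum>l<d. \<mu> $ l * X \<omega> $ l) \<partial>M)"
    using X by (subst Bochner_Integration.integral_sum) (auto simp: integrable_vec_def)
  also have "\<dots> \<le> norm2 \<mu> * c"
  proof (rule integral_le_const[OF int], rule AE_I2)
    fix \<omega> assume \<omega>: "\<omega> \<in> space M"
    hence Xc: "X \<omega> \<in> carrier_vec d" using X by (auto simp: integrable_vec_def)
    have "(\<Sum>l<d. \<mu> $ l * X \<omega> $ l) = \<mu> \<bullet> X \<omega>"
      using Xc by (simp add: scalar_prod_def atLeast0LessThan)
    also have "\<dots> \<le> norm2 \<mu> * norm2 (X \<omega>)" by (rule scalar_prod_le_norm2[OF \<mu> Xc])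
    also have "\<dots> \<le> norm2 \<mu> * c" by (rule mult_left_mono[OF bound[OF \<omega>] norm2_nonneg])
    finally show "(\<Sum>l<d. \<mu> $ l * X \<omega> $ l) \<le> norm2 \<mu> * c" .
  qed
  finally have "\<mu> \<bullet> \<mu> \<le> norm2 \<mu> * c" .
  thus ?thesis using c0 unfolding \<mu>_def by (rule norm2_le_of_self_prod)
qed

section \<open>Independence of a draw from the earlier draws\<close>

text \<open>Finitely many finite-valued variables take values in a finite discrete product space. Every function
  of them is therefore measurable and bounded, so integrability comes for free and independence
  can be used for arbitrary functions of the variables.\<close>

lemma (in prob_space) finite_valued_family:
  fixes B :: "'t \<Rightarrow> 'v set" and F :: "('t \<Rightarrow> 'v) \<Rightarrow> real"
  assumes ind: "indep_vars (\<lambda>t. count_space (B t)) X I" and B: "\<And>t. finite (B t)"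
    and A: "finite A" "A \<subseteq> I"
  shows "integrable M (\<lambda>\<omega>. F (restrict (\<lambda>t. X t \<omega>) A))"
    and "t \<in> I \<Longrightarrow> t \<notin> A \<Longrightarrow> v \<in> B t \<Longrightarrow>
      (\<integral>\<omega>. indicat_real {v} (X t \<omega>) * F (restrict (\<lambda>t. X t \<omega>) A) \<partial>M)
      = measure M {\<omega> \<in> space M. X t \<omega> = v} * (\<integral>\<omega>. F (restrict (\<lambda>t. X t \<omega>) A) \<partial>M)"
proof -
  have PiM_eq: "PiM K (\<lambda>t. count_space (B t)) = count_space (PiE K B)" if "finite K" for K
    using that B by (intro count_space_PiM_finite) (auto intro: countable_finite)
  have X: "X t \<in> measurable M (count_space (B t))" if "t \<in> I" for t
    using ind that unfolding indep_vars_def by auto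
  have XB: "X t \<omega> \<in> B t" if "t \<in> I" "\<omega> \<in> space M" for t \<omega>
    using measurable_space[OF X[OF that(1)] that(2)] by simp
  have mX: "(\<lambda>\<omega>. restrict (\<lambda>t. X t \<omega>) K) \<in> measurable M (count_space (PiE K B))"
    if "finite K" "K \<subseteq> I" for K
    unfolding PiM_eq[OF that(1), symmetric] using X that by (intro measurable_restrict) auto
  have integ: "integrable M (\<lambda>\<omega>. H (restrict (\<lambda>t. X t \<omega>) K))"
    if K: "finite K" "K \<subseteq> I" for K and H :: "('t \<Rightarrow> 'v) \<Rightarrow> real"
  proof (rule integrable_const_bound[of _ "\<Sum>y\<in>PiE K B. \<bar>H y\<bar>"])
    have fin: "finite (PiE K B)" using K B by (intro finite_PiE) auto
    show "AE \<omega> in M. norm (H (restrict (\<lambda>t. X t \<omega>) K)) \<le> (\<Sum>y\<in>PiE K B. \<bar>H y\<bar>)"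
    proof (rule AE_I2)
      fix \<omega> assume "\<omega> \<in> space M"
      hence "restrict (\<lambda>t. X t \<omega>) K \<in> PiE K B" using XB K by auto
      thus "norm (H (restrict (\<lambda>t. X t \<omega>) K)) \<le> (\<Sum>y\<in>PiE K B. \<bar>H y\<bar>)"
        unfolding real_norm_def using fin by (intro member_le_sum) auto
    qed
    show "(\<lambda>\<omega>. H (restrict (\<lambda>t. X t \<omega>) K)) \<in> borel_measurable M"
      by (rule measurable_compose[OF mX[OF K]]) simp
  qed
  show "integrable M (\<lambda>\<omega>. F (restrict (\<lambda>t. X t \<omega>) A))" by (rule integ[OF A])
  assume t: "t \<in> I" "t \<notin> A" and v: "v \<in> B t"
  define G :: "('t \<Rightarrow> 'v) \<Rightarrow> real" where "G = (\<lambda>y. indicator {v} (y t))"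
  have "indep_var (PiM {t} (\<lambda>t. count_space (B t))) (\<lambda>\<omega>. restrict (\<lambda>t. X t \<omega>) {t})
      (PiM A (\<lambda>t. count_space (B t))) (\<lambda>\<omega>. restrict (\<lambda>t. X t \<omega>) A)"
    using t A by (intro indep_var_restrict[OF ind]) auto
  hence "indep_var borel (G \<circ> (\<lambda>\<omega>. restrict (\<lambda>t. X t \<omega>) {t}))
      borel (F \<circ> (\<lambda>\<omega>. restrict (\<lambda>t. X t \<omega>) A))"
    by (rule indep_var_compose) (simp_all add: PiM_eq A)
  hence "(\<integral>\<omega>. G (restrict (\<lambda>t. X t \<omega>) {t}) * F (restrict (\<lambda>t. X t \<omega>) A) \<partial>M)
      = (\<integral>\<omega>. G (restrict (\<lambda>t. X t \<omega>) {t}) \<partial>M) * (\<integral>\<omega>. F (restrict (\<lambda>t. X t \<omega>) A) \<partial>M)"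
    unfolding comp_def using t A by (intro indep_var_lebesgue_integral integ) auto
  moreover have "(\<integral>\<omega>. G (restrict (\<lambda>t. X t \<omega>) {t}) \<partial>M) = measure M {\<omega> \<in> space M. X t \<omega> = v}"
  proof -
    have "{\<omega> \<in> space M. X t \<omega> = v} = X t -` {v} \<inter> space M" by auto
    hence sets: "{\<omega> \<in> space M. X t \<omega> = v} \<in> sets M"
      using measurable_sets[OF X[OF t(1)], of "{v}"] v by simp
    have "(\<integral>\<omega>. G (restrict (\<lambda>t. X t \<omega>) {t}) \<partial>M) = (\<integral>\<omega>. indicator {\<omega> \<in> space M. X t \<omega> = v} \<omega> \<partial>M)"
      by (intro Bochner_Integration.integral_cong) (auto simp: G_def indicator_def)
    thus ?thesis using sets by (simp add: Int_absorb2 sets.sets_into_space)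
  qed
  ultimately show "(\<integral>\<omega>. indicat_real {v} (X t \<omega>) * F (restrict (\<lambda>t. X t \<omega>) A) \<partial>M)
      = measure M {\<omega> \<in> space M. X t \<omega> = v} * (\<integral>\<omega>. F (restrict (\<lambda>t. X t \<omega>) A) \<partial>M)"
    by (simp add: G_def)
qed

section \<open>The random iterates\<close>

text \<open>The iterates depend only on the draws made so far. This is what makes the next row index independent
  of them.\<close>

lemma rdbk_z_cong:
  assumes "\<forall>l\<in>{1..k}. jj l = jj' l"
  shows "rdbk_z M b \<nu> jj k = rdbk_z M b \<nu> jj' k"
  using assms by (induction k) (simp_all add: Let_def)

lemma rdbk_x_cong:
  assumes "\<forall>l\<in>{1..k}. ii l = ii' l" and "\<forall>l\<in>{1..k}. jj l = jj' l"
  shows "rdbk_x M b \<tau> \<nu> x0 ii jj k = rdbk_x M b \<tau> \<nu> x0 ii' jj' k"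
  using assms
proof (induction k)
  case (Suc k)
  have "rdbk_z M b \<nu> jj (Suc k) = rdbk_z M b \<nu> jj' (Suc k)"
    using Suc.prems(2) by (rule rdbk_z_cong)
  thus ?case using Suc by (simp add: Let_def del: rdbk_z.simps)
qed simp

lemma rdbk_z_bounded:
  assumes M: "M \<in> carrier_mat m n" and b: "b \<in> carrier_vec m"
  shows "rdbk_z M b \<nu> jj k \<in> carrier_vec m" and "norm2 (rdbk_z M b \<nu> jj k) \<le> norm2 b"
proof (induction k)
  case (Suc k)
  {
    case 1
    have C: "col_block M (\<nu> (jj (Suc k))) \<in> carrier_mat m (card {l. l < n \<and> l \<in> \<nu> (jj (Suc k))})"
      by (rule col_block_carrier[OF M])
    hence "col_block M (\<nu> (jj (Suc k))) *\<^sub>v (pinv (col_block M (\<nu> (jj (Suc k)))) *\<^sub>v rdbk_z M b \<nu> jj k)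
        \<in> carrier_vec m"
      using pinvD(1)[OF C C] Suc(1) by (meson mult_mat_vec_carrier)
    thus ?case using Suc(1) by (simp add: Let_def)
  next
    case 2
    show ?case
      using range_projector_contracts[OF col_block_carrier[OF M] Suc(1), of "\<nu> (jj (Suc k))"] Suc(2)
      by (simp add: Let_def)
  }
qed (use b in auto)

lemma rdbk_x_carrier:
  assumes M: "M \<in> carrier_mat m n" and b: "b \<in> carrier_vec m" and x0: "x0 \<in> carrier_vec n"
  shows "rdbk_x M b \<tau> \<nu> x0 ii jj k \<in> carrier_vec n"
proof (induction k)
  case (Suc k)
  let ?I = "\<tau> (ii (Suc k))"
  note R = row_block_carrier[OF M, of ?I]
  have "vec_block b ?I - vec_block (rdbk_z M b \<nu> jj (Suc k)) ?I
      - row_block M ?I *\<^sub>v rdbk_x M b \<tau> \<nu> x0 ii jj k \<in> carrier_vec (card {l. l < m \<and> l \<in> ?I})"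
    using mult_mat_vec_carrier[OF R Suc] by (rule minus_carrier_vec[rotated])
      (use vec_block_carrier[of b ?I] vec_block_carrier[of "rdbk_z M b \<nu> jj (Suc k)" ?I]
        rdbk_z_bounded(1)[OF M b, of \<nu> jj "Suc k"] b in \<open>auto simp del: rdbk_z.simps\<close>)
  hence "pinv (row_block M ?I) *\<^sub>v (vec_block b ?I - vec_block (rdbk_z M b \<nu> jj (Suc k)) ?I
      - row_block M ?I *\<^sub>v rdbk_x M b \<tau> \<nu> x0 ii jj k) \<in> carrier_vec n"
    by (rule mult_mat_vec_carrier[OF pinvD(1)[OF R R]])
  thus ?case using Suc by (simp add: Let_def del: rdbk_z.simps)
qed (simp add: x0)

lemma rdbk_step_error:
  fixes R :: "real mat"
  assumes R: "R \<in> carrier_mat d n" and x: "x \<in> carrier_vec n" and y: "y \<in> carrier_vec n"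
    and b: "b \<in> carrier_vec d" and z: "z \<in> carrier_vec d"
  shows "x + pinv R *\<^sub>v (b - z - R *\<^sub>v x) - y
    = (1\<^sub>m n - row_projector R) *\<^sub>v (x - y)
      + ((pinv R *\<^sub>v b - row_projector R *\<^sub>v y) + (- pinv R) *\<^sub>v z)"
proof -
  note X = pinvD(1)[OF R R] and P = row_projector(1)[OF R]
  have Rx: "R *\<^sub>v x \<in> carrier_vec d" using R x by simp
  have Px: "pinv R *\<^sub>v (R *\<^sub>v x) = row_projector R *\<^sub>v x"
    unfolding row_projector_def by (rule assoc_mult_mat_vec[OF X R x, symmetric])
  have "pinv R *\<^sub>v (b - z - R *\<^sub>v x) = pinv R *\<^sub>v b - pinv R *\<^sub>v z - row_projector R *\<^sub>v x"
    using b z Rx by (simp add: mult_minus_distrib_mat_vec[OF X] Px)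
  moreover have "(1\<^sub>m n - row_projector R) *\<^sub>v (x - y)
      = (x - y) - (row_projector R *\<^sub>v x - row_projector R *\<^sub>v y)"
    using x y P by (simp add: minus_mult_distrib_mat_vec[of _ n n] mult_minus_distrib_mat_vec[OF P])
  moreover have "(- pinv R) *\<^sub>v z = - (pinv R *\<^sub>v z)"
    using X z by (intro eq_vecI) auto
  ultimately show ?thesis
    using x y X P b z by (intro eq_vecI) (simp_all del: index_mult_mat_vec)
qed

lemma rdbk_draws_finite_dependence:
  fixes G :: "(nat \<Rightarrow> nat) \<Rightarrow> (nat \<Rightarrow> nat) \<Rightarrow> real"
  assumes draws: "rdbk_draws P M p \<tau> q \<nu> i j"
    and G: "\<And>ii ii' jj jj'. \<forall>l\<in>{1..k}. ii l = ii' l \<Longrightarrow> \<forall>l\<in>{1..h}. jj l = jj' l \<Longrightarrow> G ii jj = G ii' jj'"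
  shows "integrable P (\<lambda>\<omega>. G (\<lambda>l. i l \<omega>) (\<lambda>l. j l \<omega>))"
    and "k < t \<Longrightarrow> s < p \<Longrightarrow>
      (\<integral>\<omega>. indicat_real {s} (i t \<omega>) * G (\<lambda>l. i l \<omega>) (\<lambda>l. j l \<omega>) \<partial>P)
      = (frob_norm (row_block M (\<tau> s)))\<^sup>2 / (frob_norm M)\<^sup>2 * (\<integral>\<omega>. G (\<lambda>l. i l \<omega>) (\<lambda>l. j l \<omega>) \<partial>P)"
proof -
  interpret prob_space P using draws by (simp add: rdbk_draws_def)
  define B where "B = case_sum (\<lambda>_::nat. {..<p}) (\<lambda>_::nat. {..<q})"
  define A :: "(nat + nat) set" where "A = {1..k} <+> {1..h}"
  have "case_sum (\<lambda>_::nat. count_space {..<p}) (\<lambda>_::nat. count_space {..<q}) = (\<lambda>t. count_space (B t))"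
    by (auto simp: B_def fun_eq_iff split: sum.split)
  hence ind: "indep_vars (\<lambda>t. count_space (B t)) (case_sum i j) ({1..} <+> {1..})"
    using draws by (simp add: rdbk_draws_def)
  have B: "finite (B t)" for t by (auto simp: B_def split: sum.split)
  have A: "finite A" "A \<subseteq> {1..} <+> {1..}" by (auto simp: A_def)
  define F where "F = (\<lambda>y. G (\<lambda>l. y (Inl l)) (\<lambda>l. y (Inr l)))"
  have FG: "F (restrict (\<lambda>t. case_sum i j t \<omega>) A) = G (\<lambda>l. i l \<omega>) (\<lambda>l. j l \<omega>)" for \<omega>
    unfolding F_def by (rule G) (auto simp: A_def)
  note fam = finite_valued_family[OF ind B A, where F = F]
  show "integrable P (\<lambda>\<omega>. G (\<lambda>l. i l \<omega>) (\<lambda>l. j l \<omega>))" using fam(1) by (simp only: FG)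
  assume t: "k < t" and s: "s < p"
  have "measure P {\<omega> \<in> space P. i t \<omega> = s} = (frob_norm (row_block M (\<tau> s)))\<^sup>2 / (frob_norm M)\<^sup>2"
    using draws t s by (simp add: rdbk_draws_def)
  moreover have t': "Inl t \<in> {1..} <+> {1..}" "Inl t \<notin> A" "s \<in> B (Inl t)"
    using t s by (auto simp: A_def B_def)
  ultimately show "(\<integral>\<omega>. indicat_real {s} (i t \<omega>) * G (\<lambda>l. i l \<omega>) (\<lambda>l. j l \<omega>) \<partial>P)
      = (frob_norm (row_block M (\<tau> s)))\<^sup>2 / (frob_norm M)\<^sup>2 * (\<integral>\<omega>. G (\<lambda>l. i l \<omega>) (\<lambda>l. j l \<omega>) \<partial>P)"
    using fam(2)[OF t'] by (simp only: FG sum.case)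
qed

text \<open>The weights sum to one because the drawn index, being a random variable with values in \<open>{..<p}\<close>,
  always hits one of the blocks. In particular the Frobenius norm of the matrix cannot vanish.\<close>

lemma rdbk_draws_row_index:
  assumes draws: "rdbk_draws P M p \<tau> q \<nu> i j" and t: "1 \<le> t"
  shows "\<And>\<omega>. \<omega> \<in> space P \<Longrightarrow> i t \<omega> < p"
    and "(\<Sum>s<p. (frob_norm (row_block M (\<tau> s)))\<^sup>2 / (frob_norm M)\<^sup>2) = 1"
proof -
  interpret prob_space P using draws by (simp add: rdbk_draws_def)
  have "indep_vars (case_sum (\<lambda>_. count_space {..<p}) (\<lambda>_. count_space {..<q})) (case_sum i j) ({1..} <+> {1..})"
    using draws by (simp add: rdbk_draws_def)
  hence meas: "i t \<in> measurable P (count_space {..<p})"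
    using t unfolding indep_vars_def by (auto dest!: conjunct1 bspec[of _ _ "Inl t"])
  show lt: "i t \<omega> < p" if "\<omega> \<in> space P" for \<omega> using measurable_space[OF meas that] by simp
  define E where "E = (\<lambda>s. {\<omega> \<in> space P. i t \<omega> = s})"
  have "E s \<in> sets P" if "s < p" for s
  proof -
    have "E s = i t -` {s} \<inter> space P" by (auto simp: E_def)
    thus ?thesis using measurable_sets[OF meas, of "{s}"] that by simp
  qed
  hence "measure P (\<Union>s<p. E s) = (\<Sum>s<p. measure P (E s))"
    by (intro finite_measure_finite_Union) (auto simp: disjoint_family_on_def E_def)
  moreover have "(\<Union>s<p. E s) = space P" using lt by (auto simp: E_def)
  moreover have "measure P (E s) = (frob_norm (row_block M (\<tau> s)))\<^sup>2 / (frob_norm M)\<^sup>2" if "s < p" for s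
    using draws that t by (simp add: rdbk_draws_def E_def)
  ultimately show "(\<Sum>s<p. (frob_norm (row_block M (\<tau> s)))\<^sup>2 / (frob_norm M)\<^sup>2) = 1"
    by (simp add: prob_space)
qed

lemma rdbk_draws_integrable_vec:
  assumes draws: "rdbk_draws P M p \<tau> q \<nu> i j"
    and G: "\<And>ii ii' jj jj'. \<forall>l\<in>{1..k}. ii l = ii' l \<Longrightarrow> \<forall>l\<in>{1..h}. jj l = jj' l \<Longrightarrow> G ii jj = G ii' jj'"
    and d: "\<And>ii jj. G ii jj \<in> carrier_vec d"
  shows "integrable_vec P d (\<lambda>\<omega>. G (\<lambda>l. i l \<omega>) (\<lambda>l. j l \<omega>))"
  unfolding integrable_vec_def
proof (intro conjI ballI allI impI d)
  fix l
  have "(\<lambda>ii jj. G ii jj $ l) ii jj = (\<lambda>ii jj. G ii jj $ l) ii' jj'"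
    if "\<forall>l\<in>{1..k}. ii l = ii' l" "\<forall>l\<in>{1..h}. jj l = jj' l" for ii ii' jj jj'
    using G[OF that] by simp
  thus "integrable P (\<lambda>\<omega>. G (\<lambda>l. i l \<omega>) (\<lambda>l. j l \<omega>) $ l)"
    by (rule rdbk_draws_finite_dependence(1)[OF draws])
qed

text \<open>Conditioning on the row index drawn at time \<open>t\<close>: the expectation of a quantity that depends on this
  index and otherwise only on row indices before \<open>t\<close> and on column indices is the mean over the
  blocks, weighted by their probabilities. The column index drawn at time \<open>t\<close> itself may enter, as
  the step for \<open>x\<close> uses the \<open>z\<close> of the same time.\<close>

lemma rdbk_draws_next_row:
  assumes draws: "rdbk_draws P M p \<tau> q \<nu> i j" and t: "k < t"
    and G: "\<And>s ii ii' jj jj'. \<forall>l\<in>{1..k}. ii l = ii' l \<Longrightarrow> \<forall>l\<in>{1..h}. jj l = jj' l \<Longrightarrow> G s ii jj = G s ii' jj'"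
  shows "expect_vec P d (\<lambda>\<omega>. G (i t \<omega>) (\<lambda>l. i l \<omega>) (\<lambda>l. j l \<omega>))
    = mean_vec d p (\<lambda>s. (frob_norm (row_block M (\<tau> s)))\<^sup>2 / (frob_norm M)\<^sup>2)
        (\<lambda>s. expect_vec P d (\<lambda>\<omega>. G s (\<lambda>l. i l \<omega>) (\<lambda>l. j l \<omega>)))"
proof (rule eq_vecI)
  define w where "w = (\<lambda>s. (frob_norm (row_block M (\<tau> s)))\<^sup>2 / (frob_norm M)\<^sup>2)"
  fix l assume "l < dim_vec (mean_vec d p (\<lambda>s. (frob_norm (row_block M (\<tau> s)))\<^sup>2 / (frob_norm M)\<^sup>2)
        (\<lambda>s. expect_vec P d (\<lambda>\<omega>. G s (\<lambda>l. i l \<omega>) (\<lambda>l. j l \<omega>))))"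
  hence l: "l < d" by (simp add: mean_vec_def)
  define g where "g = (\<lambda>s ii jj. G s ii jj $ l)"
  have g: "g s ii jj = g s ii' jj'"
    if "\<forall>l\<in>{1..k}. ii l = ii' l" "\<forall>l\<in>{1..h}. jj l = jj' l" for s ii ii' jj jj'
    using G[OF that] by (simp add: g_def)
  have int: "integrable P (\<lambda>\<omega>. indicat_real {s} (i t \<omega>) * g s (\<lambda>l. i l \<omega>) (\<lambda>l. j l \<omega>))" for s
  proof -
    have "(\<lambda>ii jj. indicat_real {s} (ii t) * g s ii jj) ii jj
        = (\<lambda>ii jj. indicat_real {s} (ii t) * g s ii jj) ii' jj'"
      if "\<forall>l\<in>{1..t}. ii l = ii' l" "\<forall>l\<in>{1..h}. jj l = jj' l" for ii ii' jj jj'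
    proof -
      have "g s ii jj = g s ii' jj'" using that t by (intro g) auto
      thus ?thesis using that(1) t by simp
    qed
    thus ?thesis by (rule rdbk_draws_finite_dependence(1)[OF draws])
  qed
  have "(\<integral>\<omega>. g (i t \<omega>) (\<lambda>l. i l \<omega>) (\<lambda>l. j l \<omega>) \<partial>P)
      = (\<integral>\<omega>. (\<Sum>s<p. indicat_real {s} (i t \<omega>) * g s (\<lambda>l. i l \<omega>) (\<lambda>l. j l \<omega>)) \<partial>P)"
  proof (rule Bochner_Integration.integral_cong[OF refl])
    fix \<omega> assume "\<omega> \<in> space P"
    hence "i t \<omega> < p" using rdbk_draws_row_index(1)[OF draws, of t] t by simp
    moreover have "(\<Sum>s<p. indicat_real {s} (i t \<omega>) * g s (\<lambda>l. i l \<omega>) (\<lambda>l. j l \<omega>))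
        = (\<Sum>s<p. if s = i t \<omega> then g s (\<lambda>l. i l \<omega>) (\<lambda>l. j l \<omega>) else 0)"
      by (intro sum.cong) (auto simp: indicator_def)
    ultimately show "g (i t \<omega>) (\<lambda>l. i l \<omega>) (\<lambda>l. j l \<omega>)
        = (\<Sum>s<p. indicat_real {s} (i t \<omega>) * g s (\<lambda>l. i l \<omega>) (\<lambda>l. j l \<omega>))" by simp
  qed
  also have "\<dots> = (\<Sum>s<p. (\<integral>\<omega>. indicat_real {s} (i t \<omega>) * g s (\<lambda>l. i l \<omega>) (\<lambda>l. j l \<omega>) \<partial>P))"
    by (rule Bochner_Integration.integral_sum) (rule int)
  also have "\<dots> = (\<Sum>s<p. w s * (\<integral>\<omega>. g s (\<lambda>l. i l \<omega>) (\<lambda>l. j l \<omega>) \<partial>P))"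
    unfolding w_def
    by (intro sum.cong refl rdbk_draws_finite_dependence(2)[OF draws g t]) auto
  finally show "expect_vec P d (\<lambda>\<omega>. G (i t \<omega>) (\<lambda>l. i l \<omega>) (\<lambda>l. j l \<omega>)) $ l
      = mean_vec d p (\<lambda>s. (frob_norm (row_block M (\<tau> s)))\<^sup>2 / (frob_norm M)\<^sup>2)
        (\<lambda>s. expect_vec P d (\<lambda>\<omega>. G s (\<lambda>l. i l \<omega>) (\<lambda>l. j l \<omega>))) $ l"
    using l by (simp add: expect_vec_def mean_vec_def g_def w_def)
qed (simp add: expect_vec_def mean_vec_def)

section \<open>The error recursion\<close>

text \<open>With \<open>\<delta> = x - R\<^sup>\<dagger> b\<close> and \<open>Q\<close> the row space projector, \<open>Q y - R\<^sup>\<dagger> b = Q \<delta> + Q (y - x)\<close>. The angle enters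
  through the length of \<open>Q \<delta>\<close>, and \<open>\<delta> = (x - Q x) - R\<^sup>\<dagger> (b - R x)\<close> bounds the length of \<open>\<delta>\<close>.\<close>

lemma block_noise_bound:
  fixes R :: "real mat"
  assumes R: "R \<in> carrier_mat d n" and b: "b \<in> carrier_vec d"
    and x: "x \<in> carrier_vec n" and y: "y \<in> carrier_vec n"
    and res: "norm2 (pinv R *\<^sub>v (b - R *\<^sub>v x)) \<le> \<rho>"
    and cos: "cos_angle (x - pinv R *\<^sub>v b) (mat_range (R\<^sup>T)) \<le> \<gamma>"
  shows "norm2 (pinv R *\<^sub>v b - row_projector R *\<^sub>v y) \<le> \<gamma> * (norm2 x + \<rho>) + norm2 (y - x)"
proof -
  let ?P = "row_projector R"
  note X = pinvD(1)[OF R R] and P = row_projector[OF R]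
  define xb where "xb = pinv R *\<^sub>v b"
  have xb: "xb \<in> carrier_vec n" using X b by (simp add: xb_def)
  have Pxb: "?P *\<^sub>v xb = xb" using assoc_mult_mat_vec[OF P(1) X b] P(4) by (simp add: xb_def)
  define px py where "px = ?P *\<^sub>v x" and "py = ?P *\<^sub>v y"
  have px: "px \<in> carrier_vec n" and py: "py \<in> carrier_vec n" using P(1) x y by (auto simp: px_def py_def)
  have Px: "pinv R *\<^sub>v (R *\<^sub>v x) = px"
    unfolding px_def row_projector_def by (rule assoc_mult_mat_vec[OF X R x, symmetric])
  have Rx: "R *\<^sub>v x \<in> carrier_vec d" using R x by simp
  define \<delta> where "\<delta> = x - xb"
  have \<delta>: "\<delta> \<in> carrier_vec n" using x xb by (simp add: \<delta>_def)
  have res_eq: "pinv R *\<^sub>v (b - R *\<^sub>v x) = xb - px"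
    unfolding mult_minus_distrib_mat_vec[OF X b Rx] Px xb_def ..
  have "\<delta> = (x - px) + (px - xb)" using x xb px unfolding \<delta>_def by (intro eq_vecI) auto
  hence "norm2 \<delta> \<le> norm2 (x - px) + norm2 (px - xb)"
    using norm2_triangle[of "x - px" n "px - xb"] x xb px by simp
  hence \<delta>n: "norm2 \<delta> \<le> norm2 x + \<rho>"
    using symmetric_idempotent_contracts(2)[OF P(1-3) x] res norm2_minus_commute[OF xb px]
    by (simp add: res_eq px_def[symmetric])
  have Pd: "norm2 (?P *\<^sub>v \<delta>) \<le> \<gamma> * (norm2 x + \<rho>)"
  proof -
    have "norm2 (?P *\<^sub>v \<delta>) = cos_angle \<delta> (mat_range (R\<^sup>T)) * norm2 \<delta>"
      by (rule norm2_row_projection[OF R \<delta>])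
    also have "\<dots> \<le> \<gamma> * (norm2 x + \<rho>)"
      using cos \<delta>n order_trans[OF cos_angle_nonneg cos] norm2_nonneg
      by (intro mult_mono) (simp_all add: \<delta>_def xb_def)
    finally show ?thesis .
  qed
  have yx: "y - x \<in> carrier_vec n" using x y by simp
  have P\<delta>: "?P *\<^sub>v \<delta> = px - xb"
    unfolding \<delta>_def mult_minus_distrib_mat_vec[OF P(1) x xb] Pxb px_def ..
  have Pyx: "?P *\<^sub>v (y - x) = py - px"
    unfolding mult_minus_distrib_mat_vec[OF P(1) y x] px_def py_def ..
  have "py - xb = (px - xb) + (py - px)" using xb px py by (intro eq_vecI) auto
  hence "norm2 (py - xb) \<le> norm2 (?P *\<^sub>v \<delta>) + norm2 (?P *\<^sub>v (y - x))"
    unfolding P\<delta> Pyx using norm2_triangle[of "px - xb" n "py - px"] xb px py by simp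
  also have "\<dots> \<le> \<gamma> * (norm2 x + \<rho>) + norm2 (y - x)"
    using Pd symmetric_idempotent_contracts(1)[OF P(1-3) yx] by linarith
  finally show ?thesis
    using norm2_minus_commute[OF xb py] by (simp add: xb_def py_def)
qed

text \<open>\<open>C / \<eta>\<close> is the fixed point of the recursion \<open>t \<mapsto> (1 - \<eta>) t + C\<close>.\<close>

lemma affine_contraction_iterate:
  fixes a :: "nat \<Rightarrow> real"
  assumes \<eta>: "0 < \<eta>" "\<eta> \<le> 1" and C: "0 \<le> C"
    and step: "\<And>k. a (Suc k) \<le> (1 - \<eta>) * a k + C"
  shows "a k \<le> (1 - \<eta>) ^ k * a 0 + C / \<eta>"
proof (induction k)
  case 0
  show ?case using \<eta> C by simp
next
  case (Suc k)
  have "a (Suc k) \<le> (1 - \<eta>) * ((1 - \<eta>) ^ k * a 0 + C / \<eta>) + C"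
    using step[of k] mult_left_mono[OF Suc, of "1 - \<eta>"] \<eta> by simp
  also have "\<dots> = (1 - \<eta>) ^ Suc k * a 0 + C / \<eta>" using \<eta> by (simp add: field_simps)
  finally show ?case .
qed

theorem theorem4p7:
  fixes A At :: "real mat" and b bt x0 :: "real vec"
    and m n p q k :: nat
    and \<tau> \<nu> :: "nat \<Rightarrow> nat set"
    and \<alpha>1 \<alpha>2 :: real
    and U S V :: "nat \<Rightarrow> real mat"
    and P :: "'w measure" and i j :: "nat \<Rightarrow> 'w \<Rightarrow> nat"
  assumes "0 < m" and "0 < n"
    and "A \<in> carrier_mat m n" and "At \<in> carrier_mat m n"
    and "b \<in> carrier_vec m" and "bt \<in> carrier_vec m"
    and "row_paving At p \<tau> \<alpha>1 \<alpha>2"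
    and "block_partition n q \<nu>"
    and "\<forall>s<p. full_svd (row_block At (\<tau> s)) (U s) (S s) (V s)"
    and "mat_rank (weighted_row_basis At p \<tau> V) = n"
    and "rdbk_draws P At p \<tau> q \<nu> i j"
    and "x0 \<in> carrier_vec n" and "0 < k"
  defines "xLS \<equiv> pinv A *\<^sub>v b"
    and "xtLS \<equiv> pinv At *\<^sub>v bt"
    and "xtLS_block \<equiv> \<lambda>s. pinv (row_block At (\<tau> s)) *\<^sub>v vec_block bt (\<tau> s)"
    and "At\<tau> \<equiv> weighted_row_basis At p \<tau> V"
  defines "\<eta> \<equiv> lambda_min (At\<tau> * At\<tau>\<^sup>T)"
    and "rt \<equiv> bt - At *\<^sub>v xtLS"
    and "eLS \<equiv> xLS - xtLS"
    and "cos\<theta> \<equiv> Max ((\<lambda>s. cos_angle (xtLS - xtLS_block s) (mat_range ((row_block At (\<tau> s))\<^sup>T))) ` {..<p})"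
  shows "norm2 (expect_vec P n (\<lambda>\<omega>. rdbk_x At bt \<tau> \<nu> x0 (\<lambda>l. i l \<omega>) (\<lambda>l. j l \<omega>) k - xLS))
    \<le> (1 - \<eta>) ^ k * norm2 (x0 - xLS)
      + (cos\<theta> * (norm2 xtLS + norm2 rt / sqrt \<alpha>1) + norm2 eLS + norm2 bt / sqrt \<alpha>1) / \<eta>"
proof -
  note n = \<open>0 < n\<close> and A = \<open>A \<in> carrier_mat m n\<close> and At = \<open>At \<in> carrier_mat m n\<close>
    and b = \<open>b \<in> carrier_vec m\<close> and bt = \<open>bt \<in> carrier_vec m\<close>
    and x0 = \<open>x0 \<in> carrier_vec n\<close>
    and draws = \<open>rdbk_draws P At p \<tau> q \<nu> i j\<close>
    and paving = \<open>row_paving At p \<tau> \<alpha>1 \<alpha>2\<close>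
    and svd = \<open>\<forall>s<p. full_svd (row_block At (\<tau> s)) (U s) (S s) (V s)\<close>
  interpret prob_space P using draws by (simp add: rdbk_draws_def)
  define R where "R = (\<lambda>s. row_block At (\<tau> s))"
  define d where "d = (\<lambda>s. card {l. l < m \<and> l \<in> \<tau> s})"
  define w where "w = (\<lambda>s. (frob_norm (row_block At (\<tau> s)))\<^sup>2 / (frob_norm At)\<^sup>2)"
  define Q where "Q = (\<lambda>s. row_projector (R s))"
  have R: "R s \<in> carrier_mat (d s) n" for s
    unfolding R_def d_def by (rule row_block_carrier[OF At])
  have Qs: "row_projector (R s) = Q s" and Rs: "row_block At (\<tau> s) = R s"
    and ds: "card {l. l < m \<and> l \<in> \<tau> s} = d s" for s
    by (simp_all add: Q_def R_def d_def)
  note X = pinvD(1)[OF R R] and Q = row_projector[OF R, unfolded Qs]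
  have w: "\<And>s. 0 \<le> w s" "(\<Sum>s<p. w s) = 1"
    using rdbk_draws_row_index(2)[OF draws, of 1] by (simp_all add: w_def)
  have xLS: "xLS \<in> carrier_vec n" using pinvD(1)[OF A A] b by (simp add: xLS_def)
  have xt: "xtLS \<in> carrier_vec n" using pinvD(1)[OF At At] bt by (simp add: xtLS_def)
  have rt: "rt \<in> carrier_vec m" using At xt bt by (simp add: rt_def)
  have block: "vec_block v (\<tau> s) \<in> carrier_vec (d s)" if "v \<in> carrier_vec m" for v s
    using vec_block_carrier[of v "\<tau> s"] that by (simp add: d_def)

  \<comment> \<open>the paving bound makes every row block surjective, with a pseudoinverse of norm at most
    \<open>1 / sqrt \<alpha>1\<close>\<close>
  have \<alpha>: "0 < \<alpha>1" using paving by (simp add: row_paving_def)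
  have lower: "sqrt \<alpha>1 * norm2 y \<le> norm2 ((R s)\<^sup>T *\<^sub>v y)" if s: "s < p" and y: "y \<in> carrier_vec (d s)" for s y
  proof (rule paved_block_transpose_lower_bound[OF R _ \<alpha> _ y])
    show "\<alpha>1 \<le> lambda_min (R s * (R s)\<^sup>T)" using paving s by (simp add: row_paving_def R_def)
    have part: "partition_on {..<m} (\<tau> ` {..<p})"
      using paving At by (simp add: row_paving_def block_partition_def)
    hence "\<tau> s \<noteq> {}" "\<tau> s \<subseteq> {..<m}" using s by (auto simp: partition_on_def)
    hence "{l. l < m \<and> l \<in> \<tau> s} \<noteq> {}" by auto
    thus "0 < d s" unfolding d_def by (simp add: card_gt_0_iff)
  qed
  have sq: "0 < sqrt \<alpha>1" using \<alpha> by simp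
  have pinv_block: "R s *\<^sub>v (pinv (R s) *\<^sub>v y) = y" "norm2 (pinv (R s) *\<^sub>v y) \<le> norm2 y / sqrt \<alpha>1"
    if s: "s < p" and y: "y \<in> carrier_vec (d s)" for s y
    using transpose_bounded_below_imp_pinv_right_inverse[OF R sq lower[OF s] y] by blast+
  have pinv_vec_block: "norm2 (pinv (R s) *\<^sub>v vec_block v (\<tau> s)) \<le> norm2 v / sqrt \<alpha>1"
    if s: "s < p" and v: "v \<in> carrier_vec m" for s v
    using pinv_block(2)[OF s block[OF v]] divide_right_mono[OF norm2_vec_block_le[of v "\<tau> s"], of "sqrt \<alpha>1"] sq
    by simp

  \<comment> \<open>hence the Gram matrix of the weighted basis is the mean of the row space projectors\<close>
  have rank: "mat_rank (R s) = d s" if s: "s < p" for s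
    using pinv_block(1)[OF s] mult_mat_vec_carrier[OF X[of s]] by (intro surj_imp_full_row_rank[OF R]) blast
  have svdR: "full_svd (R s) (U s) (S s) (V s)" if "s < p" for s using svd that by (simp add: R_def)
  have V: "V s \<in> carrier_mat n n" if "s < p" for s
    using svdR[OF that] R[of s] by (auto simp: full_svd_def orthonormal_mat_def)
  have dn: "d s \<le> n" if "s < p" for s
    using vec_space.rank_le_nc[OF R[of s]] rank[OF that] R[of s] by (simp add: mat_rank_def)
  define W where "W = At\<tau> * At\<tau>\<^sup>T"
  have form: "x \<bullet> (W *\<^sub>v y) = (\<Sum>s<p. w s * (x \<bullet> (Q s *\<^sub>v y)))"
    if x: "x \<in> carrier_vec n" and y: "y \<in> carrier_vec n" for x y
  proof -
    have "x \<bullet> (W *\<^sub>v y) = (\<Sum>s<p. w s * (\<Sum>l<d s. (x \<bullet> col (V s) l) * (y \<bullet> col (V s) l)))"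
      unfolding W_def At\<tau>_def w_def
      by (rule weighted_row_basis_form[OF At _ _ _ x y]) (use V rank dn in \<open>auto simp: R_def\<close>)
    also have "\<dots> = (\<Sum>s<p. w s * (x \<bullet> (Q s *\<^sub>v y)))"
      unfolding Q_def using full_svd_row_projector[OF R svdR rank x y] by (intro sum.cong) auto
    finally show ?thesis .
  qed
  have At\<tau>: "At\<tau> \<in> carrier_mat n (dim_col At\<tau>)"
    using At by (intro carrier_matI) (simp_all add: At\<tau>_def weighted_row_basis_def)
  note W = gram_symmetric(1,2)[OF At\<tau>, folded W_def]
  have \<eta>pos: "0 < \<eta>"
    unfolding \<eta>_def using full_row_rank_lambda_min_pos[OF At\<tau> _ n] \<open>mat_rank _ = n\<close> by (simp add: At\<tau>_def)

  \<comment> \<open>the deterministic noise contributed by a block\<close>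
  define cb where "cb = (\<lambda>s. xtLS_block s - Q s *\<^sub>v xLS)"
  have xb: "xtLS_block s \<in> carrier_vec n" for s
    using mult_mat_vec_carrier[OF X block[OF bt]] by (simp add: xtLS_block_def R_def)
  have cb: "cb s \<in> carrier_vec n" for s using mult_mat_vec_carrier[OF Q(1) xLS] xb by (simp add: cb_def)
  define K where "K = cos\<theta> * (norm2 xtLS + norm2 rt / sqrt \<alpha>1) + norm2 eLS"
  have cb_le: "norm2 (cb s) \<le> K" if s: "s < p" for s
    unfolding cb_def xtLS_block_def K_def eLS_def Q_def Rs
  proof (rule block_noise_bound[OF R block[OF bt] xt xLS])
    have Rx: "R s *\<^sub>v xtLS = vec_block (At *\<^sub>v xtLS) (\<tau> s)"
      unfolding R_def by (rule row_block_mult_vec[OF At xt])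
    have "vec_block rt (\<tau> s) = vec_block bt (\<tau> s) - R s *\<^sub>v xtLS"
      unfolding Rx using bt At by (intro eq_vecI) (auto simp: vec_block_def rt_def pick_le)
    thus "norm2 (pinv (R s) *\<^sub>v (vec_block bt (\<tau> s) - R s *\<^sub>v xtLS)) \<le> norm2 rt / sqrt \<alpha>1"
      using pinv_vec_block[OF s rt] by simp
    show "cos_angle (xtLS - pinv (R s) *\<^sub>v vec_block bt (\<tau> s)) (mat_range ((R s)\<^sup>T)) \<le> cos\<theta>"
      unfolding cos\<theta>_def xtLS_block_def R_def using s by (intro Max_ge) auto
  qed

  define e where "e = (\<lambda>k ii jj. rdbk_x At bt \<tau> \<nu> x0 ii jj k - xLS)"
  define z where "z = (\<lambda>k (ii :: nat \<Rightarrow> nat) jj. rdbk_z At bt \<nu> jj k)"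
  define Ee where "Ee = (\<lambda>k. expect_vec P n (\<lambda>\<omega>. e k (\<lambda>l. i l \<omega>) (\<lambda>l. j l \<omega>)))"
  have ec: "e k ii jj \<in> carrier_vec n" for k ii jj
    using rdbk_x_carrier[OF At bt x0] xLS by (simp add: e_def)
  have zc: "z k ii jj \<in> carrier_vec m" and zn: "norm2 (z k ii jj) \<le> norm2 bt" for k ii jj
    using rdbk_z_bounded[OF At bt] by (simp_all add: z_def)
  have int_e: "integrable_vec P n (\<lambda>\<omega>. e k (\<lambda>l. i l \<omega>) (\<lambda>l. j l \<omega>))" for k
  proof (rule rdbk_draws_integrable_vec[OF draws _ ec])
    fix ii ii' jj jj' :: "nat \<Rightarrow> nat"
    assume "\<forall>l\<in>{1..k}. ii l = ii' l" "\<forall>l\<in>{1..k}. jj l = jj' l"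
    thus "e k ii jj = e k ii' jj'" unfolding e_def using rdbk_x_cong by metis
  qed
  have int_z: "integrable_vec P m (\<lambda>\<omega>. z k (\<lambda>l. i l \<omega>) (\<lambda>l. j l \<omega>))" for k
  proof (rule rdbk_draws_integrable_vec[OF draws _ zc])
    fix ii ii' jj jj' :: "nat \<Rightarrow> nat"
    assume "\<forall>l\<in>{1..0::nat}. ii l = ii' l" "\<forall>l\<in>{1..k}. jj l = jj' l"
    thus "z k ii jj = z k ii' jj'" unfolding z_def using rdbk_z_cong by metis
  qed

  have step: "norm2 (Ee (Suc k)) \<le> (1 - lambda_min W) * norm2 (Ee k) + (K + norm2 bt / sqrt \<alpha>1)"
    and \<eta>1: "lambda_min W \<le> 1" and K0: "0 \<le> K + norm2 bt / sqrt \<alpha>1" for k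
  proof -
    \<comment> \<open>the next error when row block \<open>s\<close> is drawn, as a function of the two index sequences; \<open>z\<close> already
      includes the current column draw\<close>
    define G where "G = (\<lambda>s ii jj. (1\<^sub>m n - Q s) *\<^sub>v e k ii jj
        + (cb s + (- pinv (R s)) *\<^sub>v vec_block (z (Suc k) ii jj) (\<tau> s)))"
    have Ge: "e (Suc k) ii jj = G (ii (Suc k)) ii jj" for ii jj
    proof -
      define s where "s = ii (Suc k)"
      have "e (Suc k) ii jj = rdbk_x At bt \<tau> \<nu> x0 ii jj k
          + pinv (R s) *\<^sub>v (vec_block bt (\<tau> s) - vec_block (z (Suc k) ii jj) (\<tau> s)
              - R s *\<^sub>v rdbk_x At bt \<tau> \<nu> x0 ii jj k) - xLS"
        by (simp add: e_def z_def R_def s_def Let_def del: rdbk_z.simps)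
      also have "\<dots> = G s ii jj"
        unfolding G_def cb_def e_def xtLS_block_def Q_def Rs
        by (rule rdbk_step_error[OF R rdbk_x_carrier[OF At bt x0] xLS block[OF bt] block[OF zc]])
      finally show ?thesis by (simp add: s_def)
    qed
    define Ez where "Ez = expect_vec P m (\<lambda>\<omega>. z (Suc k) (\<lambda>l. i l \<omega>) (\<lambda>l. j l \<omega>))"
    have Ez: "Ez \<in> carrier_vec m" by (simp add: Ez_def)
    have Ezn: "norm2 Ez \<le> norm2 bt" unfolding Ez_def by (rule norm2_expect_vec_le[OF int_z zn])
    define g where "g = (\<lambda>s. cb s + (- pinv (R s)) *\<^sub>v vec_block Ez (\<tau> s))"
    have "Ee (Suc k) = expect_vec P n (\<lambda>\<omega>. G (i (Suc k) \<omega>) (\<lambda>l. i l \<omega>) (\<lambda>l. j l \<omega>))"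
      unfolding Ee_def by (simp only: Ge)
    also have "\<dots> = mean_vec n p w (\<lambda>s. expect_vec P n (\<lambda>\<omega>. G s (\<lambda>l. i l \<omega>) (\<lambda>l. j l \<omega>)))"
      unfolding w_def
    proof (rule rdbk_draws_next_row[OF draws lessI])
      fix s and ii ii' jj jj' :: "nat \<Rightarrow> nat"
      assume eq: "\<forall>l\<in>{1..k}. ii l = ii' l" "\<forall>l\<in>{1..Suc k}. jj l = jj' l"
      have "rdbk_x At bt \<tau> \<nu> x0 ii jj k = rdbk_x At bt \<tau> \<nu> x0 ii' jj' k"
        using eq by (intro rdbk_x_cong) auto
      moreover have "rdbk_z At bt \<nu> jj (Suc k) = rdbk_z At bt \<nu> jj' (Suc k)"
        using eq(2) by (rule rdbk_z_cong)
      ultimately show "G s ii jj = G s ii' jj'" by (simp only: G_def e_def z_def)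
    qed
    also have "(\<lambda>s. expect_vec P n (\<lambda>\<omega>. G s (\<lambda>l. i l \<omega>) (\<lambda>l. j l \<omega>))) = (\<lambda>s. Ee k - Q s *\<^sub>v Ee k + g s)"
    proof
      fix s
      have IQ: "1\<^sub>m n - Q s \<in> carrier_mat n n" by (rule minus_carrier_mat[OF Q(1)])
      have mX: "- pinv (R s) \<in> carrier_mat n (d s)" using X[of s] by simp
      note Ie = expect_vec_mult_mat[OF IQ int_e[of k]]
      note Iz = expect_vec_mult_mat[OF mX integrable_vec_block[OF int_z[of "Suc k"], of "\<tau> s", unfolded ds]]
      note Ic = expect_vec_const[OF cb[of s]]
      note Ig = expect_vec_add[OF Ic(1) Iz(1)]
      have "expect_vec P n (\<lambda>\<omega>. G s (\<lambda>l. i l \<omega>) (\<lambda>l. j l \<omega>))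
          = (1\<^sub>m n - Q s) *\<^sub>v Ee k + (cb s + (- pinv (R s)) *\<^sub>v
              expect_vec P (d s) (\<lambda>\<omega>. vec_block (z (Suc k) (\<lambda>l. i l \<omega>) (\<lambda>l. j l \<omega>)) (\<tau> s)))"
        unfolding G_def expect_vec_add(2)[OF Ie(1) Ig(1)] Ie(2) Ig(2) Iz(2) Ic(2) Ee_def ..
      also have "expect_vec P (d s) (\<lambda>\<omega>. vec_block (z (Suc k) (\<lambda>l. i l \<omega>) (\<lambda>l. j l \<omega>)) (\<tau> s)) = vec_block Ez (\<tau> s)"
        unfolding d_def Ez_def by (rule expect_vec_block[OF zc])
      also have "(1\<^sub>m n - Q s) *\<^sub>v Ee k = Ee k - Q s *\<^sub>v Ee k"
        using Q(1)[of s] by (simp add: minus_mult_distrib_mat_vec[of _ n n] Ee_def)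
      finally show "expect_vec P n (\<lambda>\<omega>. G s (\<lambda>l. i l \<omega>) (\<lambda>l. j l \<omega>)) = Ee k - Q s *\<^sub>v Ee k + g s"
        by (simp only: g_def)
    qed
    finally have rec: "Ee (Suc k) = mean_vec n p w (\<lambda>s. Ee k - Q s *\<^sub>v Ee k + g s)" .
    have Xz: "pinv (R s) *\<^sub>v vec_block Ez (\<tau> s) \<in> carrier_vec n" for s
      by (rule mult_mat_vec_carrier[OF X block[OF Ez]])
    have neg: "(- pinv (R s)) *\<^sub>v vec_block Ez (\<tau> s) = - (pinv (R s) *\<^sub>v vec_block Ez (\<tau> s))" for s
      using X[of s] block[OF Ez, of s] by (intro eq_vecI) auto
    have gc: "g s \<in> carrier_vec n" for s unfolding g_def neg using cb[of s] Xz[of s] by simp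
    have gn: "norm2 (g s) \<le> K + norm2 bt / sqrt \<alpha>1" if s: "s < p" for s
    proof -
      have "norm2 (g s) \<le> norm2 (cb s) + norm2 (- (pinv (R s) *\<^sub>v vec_block Ez (\<tau> s)))"
        unfolding g_def neg using cb[of s] Xz[of s] by (intro norm2_triangle[of _ n]) auto
      also have "norm2 (- (pinv (R s) *\<^sub>v vec_block Ez (\<tau> s))) = norm2 (pinv (R s) *\<^sub>v vec_block Ez (\<tau> s))"
        by (simp add: norm2_def scalar_prod_def)
      also have "\<dots> \<le> norm2 bt / sqrt \<alpha>1"
        using pinv_vec_block[OF s Ez] divide_right_mono[OF Ezn, of "sqrt \<alpha>1"] sq by simp
      finally show ?thesis using cb_le[OF s] by simp
    qed
    have Eec: "Ee k \<in> carrier_vec n" by (simp add: Ee_def)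
    note bound = mean_projected_step_bound[OF n W Q(1-3) w form Eec gc gn]
    show "norm2 (Ee (Suc k)) \<le> (1 - lambda_min W) * norm2 (Ee k) + (K + norm2 bt / sqrt \<alpha>1)"
      unfolding rec by (rule bound(3))
    show "lambda_min W \<le> 1" by (rule bound(1))
    show "0 \<le> K + norm2 bt / sqrt \<alpha>1" by (rule bound(2))
  qed
  have "x0 - xLS \<in> carrier_vec n" using x0 xLS by simp
  hence E0: "Ee 0 = x0 - xLS" using expect_vec_const(2) by (simp add: Ee_def e_def)
  have "norm2 (Ee k) \<le> (1 - \<eta>) ^ k * norm2 (Ee 0) + (K + norm2 bt / sqrt \<alpha>1) / \<eta>"
    by (rule affine_contraction_iterate[OF \<eta>pos])
      (use step \<eta>1 K0 in \<open>simp_all add: \<eta>_def W_def\<close>)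
  thus ?thesis unfolding E0 by (simp add: Ee_def e_def K_def)
qed

end
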